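(* Let $\mathbb{K}\in\{\mathbb{R},\mathbb{C}\}$, $d\ge 1$, and let $\mathcal{M}\subseteq\mathbb{K}^{d\times d}$ be nonempty and compact. Then there exists $T\in\mathbf{GL}_d(\mathbb{K})$ such that $$\rho\big((T^{-1}\mathcal{M}T)_{J,J}\big)\leq \sqrt{d}\,\rho(\mathcal{M})$$ for every nonempty $J\subseteq\{1,\dots,d\}$.
   Context: For a nonempty bounded set $\mathcal{M}$ of square matrices of a fixed size over $\mathbb{K}$ and an integer $t\ge 1$ let $\mathcal{S}_t := \{A(t-1)\cdots A(0) : A(s)\in\mathcal{M},\ s=0,\dots,t-1\}$ be the set of products of length $t$. The joint spectral radius is $\rho(\mathcal{M}) := \lim_{t\to\infty}\sup\{\|S\|_2 : S\in\mathcal{S}_t\}^{1/t}$, where $\|\cdot\|_2$ is the spectral norm. For $T\in\mathbf{GL}_d(\mathbb{K})$, $T^{-1}\mathcal{M}T := \{T^{-1}AT : A\in\mathcal{M}\}$. For a nonempty index set $J\subseteq\{1,\dots,d\}$ and a $d\times d$ matrix $A$, $A_{J,J}$ is the principal submatrix of $A$ obtained by deleting all rows and columns whose index is not in $J$, and for a set of $d\times d$ matrices $\mathcal{M}$, $\mathcal{M}_{J,J}:=\{A_{J,J} : A\in\mathcal{M}\}$. *)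

theory Defs
  imports
    "HOL-Analysis.Function_Topology"
    "HOL-Analysis.L2_Norm"
    "Jordan_Normal_Form.DL_Submatrix"
begin

definition euclidean_norm_vec :: "'a::real_normed_field vec \<Rightarrow> real" where
  "euclidean_norm_vec v = L2_set (\<lambda>i. norm (v $ i)) {..<dim_vec v}"

definition spectral_norm :: "'a::real_normed_field mat \<Rightarrow> real" where
  "spectral_norm A =
     (SUP v\<in>{v \<in> carrier_vec (dim_col A). euclidean_norm_vec v \<le> 1}. euclidean_norm_vec (A *\<^sub>v v))"

text \<open>\<^term>\<open>seq_prod n A t\<close> is the product \<open>A(t-1) \<cdots> A(0)\<close>, newest factor on the left;
  \<open>n\<close> is the size of the matrices and only determines the empty product.\<close>

primrec seq_prod :: "nat \<Rightarrow> (nat \<Rightarrow> 'a::semiring_1 mat) \<Rightarrow> nat \<Rightarrow> 'a mat" where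
  "seq_prod n A 0 = 1\<^sub>m n"
| "seq_prod n A (Suc t) = A t * seq_prod n A t"

definition products :: "nat \<Rightarrow> 'a::semiring_1 mat set \<Rightarrow> nat \<Rightarrow> 'a mat set" where
  "products n \<M> t = {seq_prod n A t | A. \<forall>s<t. A s \<in> \<M>}"

text \<open>Meaningful for nonempty bounded sets \<open>\<M>\<close> of \<open>n \<times> n\<close> matrices, for which the limit
  exists; the value at \<open>t = 0\<close> is irrelevant.\<close>

definition joint_spectral_radius :: "nat \<Rightarrow> 'a::real_normed_field mat set \<Rightarrow> real" where
  "joint_spectral_radius n \<M> = lim (\<lambda>t. root t (SUP S\<in>products n \<M> t. spectral_norm S))"

text \<open>The type of matrices carries no topology, so compactness is transported along the
  entry function, extended by zero. On matrices of a fixed size this is a topological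
  embedding into the product space \<open>nat \<Rightarrow> nat \<Rightarrow> 'a\<close>, i.e. \<^term>\<open>compact_mats\<close> is compactness
  for the usual (entrywise) topology.\<close>

definition entries :: "'a::zero mat \<Rightarrow> nat \<Rightarrow> nat \<Rightarrow> 'a" where
  "entries A = (\<lambda>i j. if i < dim_row A \<and> j < dim_col A then A $$ (i, j) else 0)"

definition compact_mats :: "'a::{zero,topological_space} mat set \<Rightarrow> bool" where
  "compact_mats \<M> \<longleftrightarrow> compact (entries ` \<M>)"

end

theory Submission
  imports
    "HOL-Analysis.Topology_Euclidean_Space"
    "Jordan_Normal_Form.Determinant"
    Defs
begin

text \<open>
  Suppose first that some norm satisfies \<open>\<bar>A x\<bar> \<le> c \<bar>x\<bar>\<close> for all \<open>A\<close> in \<open>\<M>\<close>. John's ellipsoid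
  theorem replaces it by a Euclidean norm, and the rate \<open>c\<close> by \<open>sqrt d * c\<close>. In coordinates in which
  this Euclidean norm is the standard one, principal submatrices are compressions and so obey the
  same bound. Norms with \<open>c\<close> as close to the joint spectral radius as desired always exist, but there
  need not be one that attains it, and the coordinates may degenerate when \<open>c\<close> decreases to the joint
  spectral radius. The point of the proof is to find coordinates that serve all rates at once.

  Two observations make this possible. The joint spectral radius of a principal submatrix does not
  change when the coordinates are rescaled one by one (\<open>joint_spectral_radius_le_weighted\<close>), so the
  Euclidean norm matters only up to diagonal scaling. And every Euclidean norm can be written as the
  standard norm of \<open>D W x\<close> with \<open>D\<close> diagonal, where \<open>W\<close> and its inverse have entries bounded in terms
  of the dimension only (\<open>pivoted_gram_schmidt\<close>). Hence for rates decreasing to the limit the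
  coordinates \<open>W\<close> have an invertible limit point. The weights \<open>D\<close> in which the approximating
  coordinates contract also work, up to a small error, for the limit coordinates: this follows by
  grouping the indices into classes of weights of comparable size (\<open>ex_common_coordinates\<close>).

  The norms come from functionals, namely from the rows of rescaled products of matrices in \<open>\<M>\<close>
  (\<open>ex_nearly_contracting_coordinates\<close>). For a norm given as a supremum of functionals, John's theorem
  up to an arbitrarily small loss follows from a direct variation of the determinant
  (\<open>nearly_optimal_form\<close>).

  Real and complex matrices are treated together, over a normed field that is also a Euclidean
  space.
\<close>

unbundle no inner_syntax and no vec_syntax

section \<open>Weighted Euclidean norms and spectral norms\<close>

text \<open>The Euclidean norm of \<open>diag(e) v\<close>. All contraction estimates are phrased with it, so that a
  diagonal change of coordinates never has to be carried out on the matrices themselves.\<close>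

definition weighted_norm :: "(nat \<Rightarrow> real) \<Rightarrow> 'a::real_normed_field vec \<Rightarrow> real" where
  "weighted_norm e v = L2_set (\<lambda>i. e i * norm (v $ i)) {..<dim_vec v}"

lemma euclidean_norm_vec_eq_weighted: "euclidean_norm_vec v = weighted_norm (\<lambda>_. 1) v"
  by (simp add: euclidean_norm_vec_def weighted_norm_def)

lemma euclidean_norm_vec_nonneg [simp]: "0 \<le> euclidean_norm_vec v"
  by (simp add: euclidean_norm_vec_def)

lemma weighted_norm_nonneg [simp]: "0 \<le> weighted_norm e v"
  by (simp add: weighted_norm_def)

lemma weighted_norm_square:
  "(weighted_norm e v)\<^sup>2 = (\<Sum>i<dim_vec v. (e i)\<^sup>2 * (norm (v $ i))\<^sup>2)"
  by (simp add: weighted_norm_def L2_set_def sum_nonneg power_mult_distrib)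

lemma mult_mat_vec_index:
  assumes "A \<in> carrier_mat m n" "x \<in> carrier_vec n" "i < m"
  shows "(A *\<^sub>v x) $ i = (\<Sum>j<n. A $$ (i, j) * x $ j)"
  using assms by (auto simp: scalar_prod_def lessThan_atLeast0 intro!: sum.cong)

text \<open>The hypothesis bounds the entries of \<open>diag(e) E diag(e)\<inverse>\<close> by \<open>\<epsilon>\<close>. The constant is crude; what
  matters is that it depends on the dimension only.\<close>

lemma weighted_norm_mult_le_entries:
  fixes E :: "'a::real_normed_field mat"
  assumes E: "E \<in> carrier_mat n n" and x: "x \<in> carrier_vec n"
    and e: "\<And>i. i < n \<Longrightarrow> 0 \<le> e i"
    and b: "\<And>i j. i < n \<Longrightarrow> j < n \<Longrightarrow> e i * norm (E $$ (i, j)) \<le> \<epsilon> * e j"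
    and eps: "0 \<le> \<epsilon>"
  shows "weighted_norm e (E *\<^sub>v x) \<le> real n * real n * \<epsilon> * weighted_norm e x"
proof -
  have dim: "dim_vec (E *\<^sub>v x) = n" "dim_vec x = n" using E x by auto
  have row: "e i * norm ((E *\<^sub>v x) $ i) \<le> real n * \<epsilon> * weighted_norm e x" if i: "i < n" for i
  proof -
    have "e i * norm ((E *\<^sub>v x) $ i) \<le> e i * (\<Sum>j<n. norm (E $$ (i, j)) * norm (x $ j))"
      unfolding mult_mat_vec_index[OF E x i]
      by (intro mult_left_mono e i order_trans[OF norm_sum]) (simp add: norm_mult)
    also have "\<dots> = (\<Sum>j<n. (e i * norm (E $$ (i, j))) * norm (x $ j))"
      by (simp add: sum_distrib_left mult.assoc)
    also have "\<dots> \<le> (\<Sum>j<n. (\<epsilon> * e j) * norm (x $ j))"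
      by (intro sum_mono mult_right_mono b i) auto
    also have "\<dots> \<le> (\<Sum>j<n. \<epsilon> * weighted_norm e x)"
    proof (intro sum_mono)
      fix j assume j: "j \<in> {..<n}"
      have "e j * norm (x $ j) \<le> weighted_norm e x"
        unfolding weighted_norm_def dim
        by (rule member_le_L2_set[where f = "\<lambda>j. e j * norm (x $ j)"]) (use j in auto)
      then show "\<epsilon> * e j * norm (x $ j) \<le> \<epsilon> * weighted_norm e x"
        using mult_left_mono[OF _ eps] by (simp add: mult.assoc)
    qed
    finally show ?thesis by simp
  qed
  have "weighted_norm e (E *\<^sub>v x) \<le> (\<Sum>i<n. e i * norm ((E *\<^sub>v x) $ i))"
    unfolding weighted_norm_def dim by (rule L2_set_le_sum) (simp add: e)
  also have "\<dots> \<le> (\<Sum>i<n. real n * \<epsilon> * weighted_norm e x)"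
    by (intro sum_mono row) auto
  finally show ?thesis by (simp add: mult.assoc)
qed

lemma euclidean_norm_mult_le_entries:
  fixes A :: "'a::real_normed_field mat"
  assumes A: "A \<in> carrier_mat n n" and x: "x \<in> carrier_vec n"
    and b: "\<And>i j. i < n \<Longrightarrow> j < n \<Longrightarrow> norm (A $$ (i, j)) \<le> C" and C: "0 \<le> C"
  shows "euclidean_norm_vec (A *\<^sub>v x) \<le> real n * real n * C * euclidean_norm_vec x"
  using weighted_norm_mult_le_entries[OF A x, of "\<lambda>_. 1" C] b C
  by (simp add: euclidean_norm_vec_eq_weighted)

lemma ex_euclidean_norm_mult_bound:
  fixes A :: "'a::real_normed_field mat"
  assumes A: "A \<in> carrier_mat n n"
  shows "\<exists>C. \<forall>x\<in>carrier_vec n. euclidean_norm_vec (A *\<^sub>v x) \<le> C * euclidean_norm_vec x"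
proof -
  have "norm (A $$ (i, j)) \<le> (\<Sum>p\<in>{..<n} \<times> {..<n}. norm (A $$ p))" if "i < n" "j < n" for i j
    by (rule member_le_sum[where f = "\<lambda>p. norm (A $$ p)"]) (use that in auto)
  then show ?thesis
    using euclidean_norm_mult_le_entries[OF A, where C = "\<Sum>p\<in>{..<n} \<times> {..<n}. norm (A $$ p)"]
    by (blast intro: sum_nonneg norm_ge_zero)
qed

lemma euclidean_norm_vec_smult:
  "euclidean_norm_vec (c \<cdot>\<^sub>v v) = norm c * euclidean_norm_vec v"
  by (simp add: euclidean_norm_vec_def L2_set_right_distrib norm_mult cong: L2_set_cong_simp)

lemma bdd_above_spectral_norm:
  fixes A :: "'a::real_normed_field mat"
  assumes A: "A \<in> carrier_mat n n"
  shows "bdd_above ((\<lambda>v. euclidean_norm_vec (A *\<^sub>v v)) `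
           {v \<in> carrier_vec (dim_col A). euclidean_norm_vec v \<le> 1})"
proof -
  obtain C where C: "\<And>x. x \<in> carrier_vec n \<Longrightarrow> euclidean_norm_vec (A *\<^sub>v x) \<le> C * euclidean_norm_vec x"
    using ex_euclidean_norm_mult_bound[OF A] by blast
  have "euclidean_norm_vec (A *\<^sub>v x) \<le> \<bar>C\<bar>" if "x \<in> carrier_vec n" "euclidean_norm_vec x \<le> 1" for x
  proof -
    have "C * euclidean_norm_vec x \<le> \<bar>C\<bar> * euclidean_norm_vec x"
      by (intro mult_right_mono) auto
    also have "\<dots> \<le> \<bar>C\<bar>" using that by (simp add: mult_left_le)
    finally show ?thesis using C[OF that(1)] by linarith
  qed
  then show ?thesis using A by (auto intro!: bdd_aboveI2[where M = "\<bar>C\<bar>"])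
qed

lemma spectral_norm_nonneg:
  fixes A :: "'a::real_normed_field mat"
  assumes A: "A \<in> carrier_mat n n"
  shows "0 \<le> spectral_norm A"
proof -
  have z: "0\<^sub>v (dim_col A) \<in> {v \<in> carrier_vec (dim_col A). euclidean_norm_vec (v::'a vec) \<le> 1}"
    by (simp add: euclidean_norm_vec_def L2_set_def)
  show ?thesis unfolding spectral_norm_def
    by (rule cSUP_upper2[OF bdd_above_spectral_norm[OF A] z]) simp
qed

lemma euclidean_norm_mult_le_spectral_norm:
  fixes A :: "'a::real_normed_field mat"
  assumes A: "A \<in> carrier_mat n n" and x: "x \<in> carrier_vec n"
  shows "euclidean_norm_vec (A *\<^sub>v x) \<le> spectral_norm A * euclidean_norm_vec x"
proof (cases "euclidean_norm_vec x = 0")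
  case True
  then show ?thesis using ex_euclidean_norm_mult_bound[OF A] x by fastforce
next
  case False
  define r where "r = euclidean_norm_vec x"
  have r: "r > 0" using False unfolding r_def by (simp add: less_le)
  define y where "y = of_real (1 / r) \<cdot>\<^sub>v x"
  have y: "y \<in> carrier_vec n" using x by (simp add: y_def)
  have ny: "euclidean_norm_vec y \<le> 1"
    using r by (simp add: y_def euclidean_norm_vec_smult norm_divide flip: r_def)
  have "euclidean_norm_vec (A *\<^sub>v y) \<le> spectral_norm A"
    unfolding spectral_norm_def
    by (rule cSUP_upper[OF _ bdd_above_spectral_norm[OF A]]) (use y ny A in auto)
  moreover have "A *\<^sub>v y = of_real (1 / r) \<cdot>\<^sub>v (A *\<^sub>v x)"
    unfolding y_def by (rule mult_mat_vec[OF A x])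
  ultimately have "euclidean_norm_vec (A *\<^sub>v x) / r \<le> spectral_norm A"
    using r by (simp add: euclidean_norm_vec_smult norm_divide)
  then show ?thesis using r by (simp add: field_simps flip: r_def)
qed

lemma spectral_norm_le:
  fixes A :: "'a::real_normed_field mat"
  assumes A: "A \<in> carrier_mat n n" and c: "0 \<le> c"
    and b: "\<And>x. x \<in> carrier_vec n \<Longrightarrow> euclidean_norm_vec (A *\<^sub>v x) \<le> c * euclidean_norm_vec x"
  shows "spectral_norm A \<le> c"
proof -
  have ne: "{v \<in> carrier_vec (dim_col A). euclidean_norm_vec (v::'a vec) \<le> 1} \<noteq> {}"
  proof -
    have "(0\<^sub>v (dim_col A) :: 'a vec) \<in> {v \<in> carrier_vec (dim_col A). euclidean_norm_vec v \<le> 1}"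
      by (simp add: euclidean_norm_vec_def L2_set_def)
    then show ?thesis by blast
  qed
  show ?thesis unfolding spectral_norm_def
  proof (rule cSUP_least[OF ne])
    fix x assume "x \<in> {v \<in> carrier_vec (dim_col A). euclidean_norm_vec (v::'a vec) \<le> 1}"
    then have x: "x \<in> carrier_vec n" "euclidean_norm_vec x \<le> 1" using A by auto
    have "c * euclidean_norm_vec x \<le> c" using x c by (simp add: mult_left_le)
    then show "euclidean_norm_vec (A *\<^sub>v x) \<le> c" using b[OF x(1)] by linarith
  qed
qed

lemma spectral_norm_mult_le:
  fixes A B :: "'a::real_normed_field mat"
  assumes A: "A \<in> carrier_mat n n" and B: "B \<in> carrier_mat n n"
  shows "spectral_norm (A * B) \<le> spectral_norm A * spectral_norm B"
proof (rule spectral_norm_le[of _ n])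
  show "A * B \<in> carrier_mat n n" using A B by simp
  show "0 \<le> spectral_norm A * spectral_norm B"
    by (intro mult_nonneg_nonneg spectral_norm_nonneg[OF A] spectral_norm_nonneg[OF B])
  fix x :: "'a vec" assume x: "x \<in> carrier_vec n"
  have "euclidean_norm_vec (A *\<^sub>v (B *\<^sub>v x)) \<le> spectral_norm A * euclidean_norm_vec (B *\<^sub>v x)"
    by (rule euclidean_norm_mult_le_spectral_norm) (use A B x in auto)
  also have "\<dots> \<le> spectral_norm A * (spectral_norm B * euclidean_norm_vec x)"
    by (intro mult_left_mono euclidean_norm_mult_le_spectral_norm[OF B x] spectral_norm_nonneg[OF A])
  finally show "euclidean_norm_vec (A * B *\<^sub>v x) \<le> spectral_norm A * spectral_norm B * euclidean_norm_vec x"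
    using A B x by (simp add: mult.assoc)
qed

section \<open>The joint spectral radius as a growth rate\<close>

lemma seq_prod_carrier:
  assumes "\<M> \<subseteq> carrier_mat n n" "\<forall>s<t. A s \<in> \<M>"
  shows "seq_prod n A t \<in> carrier_mat n n"
  using assms(2)
proof (induction t)
  case (Suc t)
  then have "A t \<in> carrier_mat n n" "seq_prod n A t \<in> carrier_mat n n" using assms(1) by auto
  then show ?case by simp
qed simp

lemma products_carrier: "\<M> \<subseteq> carrier_mat n n \<Longrightarrow> S \<in> products n \<M> t \<Longrightarrow> S \<in> carrier_mat n n"
  unfolding products_def using seq_prod_carrier by blast

lemma products_nonempty: "\<M> \<noteq> {} \<Longrightarrow> products n \<M> t \<noteq> {}"
proof -
  assume "\<M> \<noteq> {}"
  then obtain A where "A \<in> \<M>" by blast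
  then have "seq_prod n (\<lambda>_. A) t \<in> products n \<M> t" by (auto simp: products_def)
  then show ?thesis by blast
qed

lemma seq_prod_add:
  assumes M: "\<M> \<subseteq> carrier_mat n n" and A: "\<forall>k<s+t. A k \<in> \<M>"
  shows "seq_prod n A (s + t) = seq_prod n (\<lambda>k. A (k + t)) s * seq_prod n A t"
  using A
proof (induction s)
  case 0
  have "seq_prod n A t \<in> carrier_mat n n" by (rule seq_prod_carrier[OF M]) (use 0 in auto)
  then show ?case by simp
next
  case (Suc s)
  have c1: "A (s + t) \<in> carrier_mat n n" using Suc.prems M by auto
  have c2: "seq_prod n (\<lambda>k. A (k + t)) s \<in> carrier_mat n n"
    by (rule seq_prod_carrier[OF M]) (use Suc.prems in auto)
  have c3: "seq_prod n A t \<in> carrier_mat n n" by (rule seq_prod_carrier[OF M]) (use Suc.prems in auto)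
  show ?case using Suc assoc_mult_mat[OF c1 c2 c3] by simp
qed

lemma products_add:
  assumes M: "\<M> \<subseteq> carrier_mat n n" and S: "S \<in> products n \<M> (s + t)"
  obtains S1 S2 where "S1 \<in> products n \<M> s" "S2 \<in> products n \<M> t" "S = S1 * S2"
proof -
  obtain A where A: "\<forall>k<s+t. A k \<in> \<M>" and S_eq: "S = seq_prod n A (s + t)"
    using S by (auto simp: products_def)
  have "seq_prod n (\<lambda>k. A (k + t)) s \<in> products n \<M> s" using A by (auto simp: products_def)
  moreover have "seq_prod n A t \<in> products n \<M> t" using A by (auto simp: products_def)
  ultimately show ?thesis using that seq_prod_add[OF M A] S_eq by blast
qed

lemma products_mult_right:
  assumes M: "\<M> \<subseteq> carrier_mat n n" and S: "S \<in> products n \<M> t" and B: "B \<in> \<M>"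
  shows "S * B \<in> products n \<M> (Suc t)"
proof -
  obtain A where A: "\<forall>k<t. A k \<in> \<M>" and S_eq: "S = seq_prod n A t"
    using S by (auto simp: products_def)
  define A' where "A' k = (if k = 0 then B else A (k - 1))" for k
  have A': "\<forall>k<t+1. A' k \<in> \<M>" using A B by (auto simp: A'_def)
  have "B \<in> carrier_mat n n" using B M by blast
  then have "seq_prod n A' (t + 1) = S * B"
    unfolding seq_prod_add[OF M A'] by (simp add: S_eq A'_def)
  then have "S * B = seq_prod n A' (Suc t)" by simp
  moreover have "\<forall>k<Suc t. A' k \<in> \<M>" using A' by simp
  ultimately show ?thesis unfolding products_def by blast
qed

lemma products_weighted_norm_le:
  assumes M: "\<M> \<subseteq> carrier_mat n n" and c: "0 \<le> c"
    and b: "\<And>A x. A \<in> \<M> \<Longrightarrow> x \<in> carrier_vec n \<Longrightarrow> weighted_norm e (A *\<^sub>v x) \<le> c * weighted_norm e x"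
    and S: "S \<in> products n \<M> t" and x: "x \<in> carrier_vec n"
  shows "weighted_norm e (S *\<^sub>v x) \<le> c ^ t * weighted_norm e x"
proof -
  obtain A where A: "\<forall>k<t. A k \<in> \<M>" and S_eq: "S = seq_prod n A t"
    using S by (auto simp: products_def)
  show ?thesis unfolding S_eq using A
  proof (induction t)
    case 0
    then show ?case using x by simp
  next
    case (Suc t)
    have At: "A t \<in> \<M>" "A t \<in> carrier_mat n n" using Suc.prems M by auto
    have P: "seq_prod n A t \<in> carrier_mat n n" by (rule seq_prod_carrier[OF M]) (use Suc.prems in auto)
    have "weighted_norm e (seq_prod n A (Suc t) *\<^sub>v x) = weighted_norm e (A t *\<^sub>v (seq_prod n A t *\<^sub>v x))"
      using assoc_mult_mat_vec[OF At(2) P x] by simp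
    also have "\<dots> \<le> c * weighted_norm e (seq_prod n A t *\<^sub>v x)"
      by (rule b) (use At P x in auto)
    also have "\<dots> \<le> c * (c ^ t * weighted_norm e x)"
      by (rule mult_left_mono[OF _ c]) (use Suc in auto)
    finally show ?case by (simp add: mult.assoc)
  qed
qed

text \<open>The multiplicative form of Fekete's subadditive lemma: writing \<open>t = q * m + r\<close> with \<open>r < m\<close> compares \<open>a t\<close>
  with \<open>(a m) ^ q\<close> up to a constant, which the \<open>t\<close>-th root removes.\<close>

lemma submultiplicative_root_convergent:
  fixes a :: "nat \<Rightarrow> real"
  assumes nonneg: "\<And>t. 0 \<le> a t" and sub: "\<And>s t. a (s + t) \<le> a s * a t"
  shows "convergent (\<lambda>t. root t (a t))"
proof -
  define L where "L = (INF t\<in>{1..}. root t (a t))"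
  have bdd: "bdd_below ((\<lambda>t. root t (a t)) ` {1..})"
    by (rule bdd_belowI2[where m = 0]) (simp add: nonneg)
  have low: "L \<le> root t (a t)" if "t \<ge> 1" for t
    unfolding L_def by (rule cINF_lower[OF bdd]) (use that in auto)
  have L0: "0 \<le> L" unfolding L_def by (rule cINF_greatest) (auto simp: nonneg)
  have "(\<lambda>t. root t (a t)) \<longlonglongrightarrow> L"
  proof (rule LIMSEQ_I)
    fix \<epsilon> :: real assume eps: "0 < \<epsilon>"
    define g where "g = L + \<epsilon> / 2"
    have g: "g > 0" using L0 eps by (simp add: g_def)
    have "\<exists>m\<in>{1..}. root m (a m) < g"
      using cINF_less_iff[OF _ bdd, of g] eps by (auto simp: g_def L_def)
    then obtain m where m: "m \<ge> 1" and rm: "root m (a m) < g" by auto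
    have am: "a m \<le> g ^ m"
    proof -
      have "a m = root m (a m) ^ m" using m nonneg by simp
      also have "\<dots> \<le> g ^ m" by (rule power_mono) (use rm m nonneg in auto)
      finally show ?thesis .
    qed
    have mult: "a (q * m + r) \<le> (g ^ m) ^ q * a r" for q r
    proof (induction q)
      case (Suc q)
      have "a (Suc q * m + r) \<le> a m * a (q * m + r)" using sub[of m "q * m + r"] by (simp add: add.assoc)
      also have "\<dots> \<le> g ^ m * ((g ^ m) ^ q * a r)"
        by (rule mult_mono) (use Suc am nonneg g in auto)
      finally show ?case by (simp add: mult.assoc)
    qed simp
    define C where "C = 1 + (\<Sum>r<m. a r / g ^ r)"
    have C1: "C \<ge> 1" unfolding C_def using nonneg g by (simp add: sum_nonneg)
    have bound: "a t \<le> C * g ^ t" for t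
    proof -
      define r where "r = t mod m"
      have r: "r < m" using m by (simp add: r_def)
      have t: "t = (t div m) * m + r" by (simp add: r_def)
      have "a r / g ^ r \<le> (\<Sum>r<m. a r / g ^ r)"
        by (rule member_le_sum[where f = "\<lambda>r. a r / g ^ r"]) (use r nonneg g in auto)
      then have "a r / g ^ r \<le> C" by (simp add: C_def)
      then have ar: "a r \<le> C * g ^ r" using g by (simp add: field_simps)
      have "a t \<le> (g ^ m) ^ (t div m) * a r" using mult[of "t div m" r] t by simp
      also have "\<dots> \<le> (g ^ m) ^ (t div m) * (C * g ^ r)"
        by (rule mult_left_mono[OF ar]) (use g in auto)
      also have "\<dots> = C * g ^ (m * (t div m) + r)" by (simp add: power_mult power_add)
      also have "m * (t div m) + r = t" by (simp add: r_def)
      finally show ?thesis .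
    qed
    have "(\<lambda>t. root t C * g) \<longlonglongrightarrow> 1 * g"
      by (intro tendsto_intros LIMSEQ_root_const) (use C1 in auto)
    moreover have "1 * g < L + \<epsilon>" using eps by (simp add: g_def)
    ultimately have "eventually (\<lambda>t. root t C * g < L + \<epsilon>) sequentially"
      by (rule order_tendstoD)
    then obtain N where N: "\<And>t. t \<ge> N \<Longrightarrow> root t C * g < L + \<epsilon>"
      by (auto simp: eventually_sequentially)
    show "\<exists>no. \<forall>t\<ge>no. norm (root t (a t) - L) < \<epsilon>"
    proof (intro exI[of _ "max 1 N"] allI impI)
      fix t assume "max 1 N \<le> t"
      then have t: "t \<ge> 1" "t \<ge> N" by auto
      have "root t (a t) \<le> root t (C * g ^ t)" using bound t by simp
      also have "\<dots> = root t C * g" using t g by (simp add: real_root_mult real_root_power_cancel)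
      also have "\<dots> < L + \<epsilon>" by (rule N[OF t(2)])
      finally show "norm (root t (a t) - L) < \<epsilon>" using low[OF t(1)] by simp
    qed
  qed
  then show ?thesis by (rule convergentI)
qed

context
  fixes \<M> :: "'a::real_normed_field mat set" and n :: nat and C :: real
  assumes M: "\<M> \<subseteq> carrier_mat n n" and ne: "\<M> \<noteq> {}"
    and bounded: "\<And>A x. A \<in> \<M> \<Longrightarrow> x \<in> carrier_vec n \<Longrightarrow>
      euclidean_norm_vec (A *\<^sub>v x) \<le> C * euclidean_norm_vec x"
begin

lemma bdd_above_products: "bdd_above (spectral_norm ` products n \<M> t)"
proof (rule bdd_aboveI2)
  fix S assume S: "S \<in> products n \<M> t"
  have b: "euclidean_norm_vec (A *\<^sub>v x) \<le> \<bar>C\<bar> * euclidean_norm_vec x"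
    if "A \<in> \<M>" "x \<in> carrier_vec n" for A x
    by (rule order_trans[OF bounded[OF that]]) (intro mult_right_mono, auto)
  show "spectral_norm S \<le> \<bar>C\<bar> ^ t"
    by (rule spectral_norm_le[OF products_carrier[OF M S]])
       (use products_weighted_norm_le[OF M _ _ S, where c = "\<bar>C\<bar>" and e = "\<lambda>_. 1"] b
         in \<open>auto simp: euclidean_norm_vec_eq_weighted\<close>)
qed

lemma spectral_norm_le_SUP_products:
  "S \<in> products n \<M> t \<Longrightarrow> spectral_norm S \<le> (SUP S\<in>products n \<M> t. spectral_norm S)"
  by (rule cSUP_upper[OF _ bdd_above_products])

lemma SUP_products_nonneg: "0 \<le> (SUP S\<in>products n \<M> t. spectral_norm S)"
proof -
  obtain S where S: "S \<in> products n \<M> t" using products_nonempty[OF ne] by blast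
  show ?thesis
    by (rule order_trans[OF spectral_norm_nonneg[OF products_carrier[OF M S]]
      spectral_norm_le_SUP_products[OF S]])
qed

lemma joint_spectral_radius_LIMSEQ:
  "(\<lambda>t. root t (SUP S\<in>products n \<M> t. spectral_norm S)) \<longlonglongrightarrow> joint_spectral_radius n \<M>"
proof -
  have "convergent (\<lambda>t. root t (SUP S\<in>products n \<M> t. spectral_norm S))"
  proof (rule submultiplicative_root_convergent[OF SUP_products_nonneg])
    fix s t
    show "(SUP S\<in>products n \<M> (s + t). spectral_norm S)
        \<le> (SUP S\<in>products n \<M> s. spectral_norm S) * (SUP S\<in>products n \<M> t. spectral_norm S)"
    proof (rule cSUP_least[OF products_nonempty[OF ne]])
      fix S assume "S \<in> products n \<M> (s + t)"
      then obtain S1 S2 where S: "S1 \<in> products n \<M> s" "S2 \<in> products n \<M> t" "S = S1 * S2"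
        using products_add[OF M] by metis
      have "spectral_norm S \<le> spectral_norm S1 * spectral_norm S2"
        unfolding S(3) by (rule spectral_norm_mult_le) (use products_carrier[OF M] S in auto)
      also have "\<dots> \<le> (SUP S\<in>products n \<M> s. spectral_norm S) * (SUP S\<in>products n \<M> t. spectral_norm S)"
        by (intro mult_mono spectral_norm_le_SUP_products S SUP_products_nonneg
            spectral_norm_nonneg[OF products_carrier[OF M S(2)]])
      finally show "spectral_norm S \<le> \<dots>" .
    qed
  qed
  then show ?thesis unfolding joint_spectral_radius_def by (simp add: convergent_LIMSEQ_iff)
qed

lemma joint_spectral_radius_nonneg: "0 \<le> joint_spectral_radius n \<M>"
  by (rule LIMSEQ_le_const[OF joint_spectral_radius_LIMSEQ])
     (auto intro!: exI[of _ 0] real_root_ge_zero SUP_products_nonneg)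

text \<open>Long products are controlled by the limit itself; the finitely many short ones, which the limit
  does not see, are absorbed into the constant \<open>K\<close>.\<close>

lemma products_growth:
  assumes "joint_spectral_radius n \<M> < \<gamma>"
  obtains K where "\<And>t S. S \<in> products n \<M> t \<Longrightarrow> spectral_norm S \<le> K * \<gamma> ^ t"
proof -
  define a where "a t = (SUP S\<in>products n \<M> t. spectral_norm S)" for t
  have a0: "0 \<le> a t" for t unfolding a_def by (rule SUP_products_nonneg)
  have g: "\<gamma> > 0" using assms joint_spectral_radius_nonneg by linarith
  have "eventually (\<lambda>t. root t (a t) < \<gamma>) sequentially"
    using order_tendstoD(2)[OF joint_spectral_radius_LIMSEQ assms] by (simp add: a_def)
  then obtain N where N: "\<And>t. t \<ge> N \<Longrightarrow> root t (a t) < \<gamma>"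
    by (auto simp: eventually_sequentially)
  \<comment> \<open>The summand one makes the constant also cover the products longer than
    \<open>N\<close>.\<close>
  define K where "K = 1 + (\<Sum>t\<le>N. a t / \<gamma> ^ t)"
  have K1: "K \<ge> 1" unfolding K_def using a0 g by (simp add: sum_nonneg)
  have "a t \<le> K * \<gamma> ^ t" for t
  proof (cases "t \<le> N")
    case True
    have "a t / \<gamma> ^ t \<le> (\<Sum>t\<le>N. a t / \<gamma> ^ t)"
      by (rule member_le_sum[where f = "\<lambda>t. a t / \<gamma> ^ t"]) (use True a0 g in auto)
    then have "a t / \<gamma> ^ t \<le> K" by (simp add: K_def)
    then show ?thesis using g by (simp add: field_simps)
  next
    case False
    then have "a t = root t (a t) ^ t" using a0 by simp
    also have "\<dots> \<le> \<gamma> ^ t" by (rule power_mono) (use N[of t] False a0 in auto)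
    also have "\<dots> \<le> K * \<gamma> ^ t" using K1 g by simp
    finally show ?thesis .
  qed
  then show ?thesis using that[of K] spectral_norm_le_SUP_products unfolding a_def
    by (meson order_trans)
qed

end

text \<open>All norms are equivalent up to a constant, and a constant disappears under the \<open>t\<close>-th root. So a
  common contraction rate in any weighted norm, whatever the condition number of the weights, bounds
  the joint spectral radius. This is why diagonal scaling can be used freely.\<close>

lemma joint_spectral_radius_le_weighted:
  fixes \<M> :: "'a::real_normed_field mat set"
  assumes M: "\<M> \<subseteq> carrier_mat n n" and ne: "\<M> \<noteq> {}" and c: "0 < c"
    and e: "\<And>i. i < n \<Longrightarrow> 0 < e i"
    and b: "\<And>A x. A \<in> \<M> \<Longrightarrow> x \<in> carrier_vec n \<Longrightarrow> weighted_norm e (A *\<^sub>v x) \<le> c * weighted_norm e x"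
  shows "joint_spectral_radius n \<M> \<le> c"
proof -
  define lo where "lo = Min (insert 1 (e ` {..<n}))"
  define hi where "hi = Max (insert 1 (e ` {..<n}))"
  have lo: "lo > 0" unfolding lo_def by (subst Min_gr_iff) (auto simp: e)
  have lohi: "lo \<le> e i" "e i \<le> hi" if "i < n" for i
    unfolding lo_def hi_def using that by (auto intro!: Min_le Max_ge)
  have hi: "hi > 0" unfolding hi_def by (subst Max_gr_iff) auto
  have lower: "lo * euclidean_norm_vec x \<le> weighted_norm e x"
    and upper: "weighted_norm e x \<le> hi * euclidean_norm_vec x" if "x \<in> carrier_vec n" for x :: "'a vec"
  proof -
    have dim: "dim_vec x = n" using that by simp
    have "L2_set (\<lambda>i. lo * norm (x $ i)) {..<n} \<le> L2_set (\<lambda>i. e i * norm (x $ i)) {..<n}"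
      by (intro L2_set_mono mult_right_mono mult_nonneg_nonneg) (use lo lohi in auto)
    then show "lo * euclidean_norm_vec x \<le> weighted_norm e x"
      using lo by (simp add: dim euclidean_norm_vec_def weighted_norm_def L2_set_right_distrib)
    have "L2_set (\<lambda>i. e i * norm (x $ i)) {..<n} \<le> L2_set (\<lambda>i. hi * norm (x $ i)) {..<n}"
      by (intro L2_set_mono mult_right_mono mult_nonneg_nonneg) (use e lohi in \<open>auto simp: less_imp_le\<close>)
    then show "weighted_norm e x \<le> hi * euclidean_norm_vec x"
      using hi by (simp add: dim euclidean_norm_vec_def weighted_norm_def L2_set_right_distrib)
  qed
  have key: "euclidean_norm_vec (S *\<^sub>v x) \<le> hi / lo * c ^ t * euclidean_norm_vec x"
    if S: "S \<in> products n \<M> t" and x: "x \<in> carrier_vec n" for S x t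
  proof -
    have "lo * euclidean_norm_vec (S *\<^sub>v x) \<le> weighted_norm e (S *\<^sub>v x)"
      by (rule lower) (use products_carrier[OF M S] x in auto)
    also have "\<dots> \<le> c ^ t * weighted_norm e x"
      by (rule products_weighted_norm_le[OF M _ b S x]) (use c in auto)
    also have "\<dots> \<le> c ^ t * (hi * euclidean_norm_vec x)"
      by (rule mult_left_mono[OF upper[OF x]]) (use c in auto)
    finally show ?thesis using lo by (simp add: field_simps)
  qed
  have M1: "A \<in> products n \<M> 1" if "A \<in> \<M>" for A
  proof -
    have "A \<in> carrier_mat n n" using M that by blast
    then have "A = seq_prod n (\<lambda>_. A) 1" by simp
    then show ?thesis using that unfolding products_def by blast
  qed
  have bounded: "euclidean_norm_vec (A *\<^sub>v x) \<le> (hi / lo * c) * euclidean_norm_vec x"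
    if "A \<in> \<M>" "x \<in> carrier_vec n" for A x
    using key[OF M1[OF that(1)] that(2)] by simp
  have SUP: "(SUP S\<in>products n \<M> t. spectral_norm S) \<le> hi / lo * c ^ t" for t
    by (rule cSUP_least[OF products_nonempty[OF ne]], rule spectral_norm_le[OF products_carrier[OF M]])
       (use key lo hi c in auto)
  have "(\<lambda>t. root t (hi / lo) * c) \<longlonglongrightarrow> 1 * c"
    by (intro tendsto_intros LIMSEQ_root_const) (use lo hi in auto)
  moreover have "root t (SUP S\<in>products n \<M> t. spectral_norm S) \<le> root t (hi / lo) * c" if "t \<ge> 1" for t
  proof -
    have "root t (SUP S\<in>products n \<M> t. spectral_norm S) \<le> root t (hi / lo * c ^ t)"
      using SUP that by simp
    also have "\<dots> = root t (hi / lo) * c"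
      unfolding real_root_mult using that c by (simp add: real_root_power_cancel)
    finally show ?thesis .
  qed
  ultimately have "joint_spectral_radius n \<M> \<le> 1 * c"
    by (intro LIMSEQ_le[OF joint_spectral_radius_LIMSEQ[OF M ne bounded]]) auto
  then show ?thesis by simp
qed

section \<open>Conjugation in a real normed field with an inner product\<close>

text \<open>The trace \<open>z + cnj z = 2 Re z\<close> written with the inner product. It is the identity on the reals and
  complex conjugation on the complex numbers, and lets both fields be treated at once: everything
  needed follows from multiplicativity of the norm, as in a composition algebra.\<close>

definition field_cnj :: "'a::{real_normed_field,real_inner} \<Rightarrow> 'a" where
  "field_cnj x = of_real (2 * inner x 1) - x"

text \<open>Multiplication by \<open>field_cnj x\<close> is the adjoint of multiplication by \<open>x\<close>. The identity is the
  polarisation of \<open>norm (x * y) = norm x * norm y\<close> in both variables, with one of the four arguments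
  set to one.\<close>

lemma inner_mult_left_field_cnj:
  fixes x y z :: "'a::{real_normed_field,real_inner}"
  shows "inner (x * y) z = inner y (field_cnj x * z)"
proof -
  have sq: "inner (u * v) (u * v) = inner u u * inner v v" for u v :: 'a
    by (simp add: norm_mult power_mult_distrib flip: power2_norm_eq_inner)
  have lin1: "inner (u * v) (w * v) = inner u w * inner v v" for u v w :: 'a
    using sq[of "u + w" v] sq[of u v] sq[of w v]
    by (simp add: algebra_simps inner_add_left inner_add_right inner_commute)
  have "inner (x * y) z + inner (x * z) y = 2 * inner x 1 * inner y z"
    using lin1[of x "y + z" 1] lin1[of x y 1] lin1[of x z 1]
    by (simp add: algebra_simps inner_add_left inner_add_right inner_commute)
  moreover have "field_cnj x * z = (2 * inner x 1) *\<^sub>R z - x * z"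
    by (simp add: field_cnj_def left_diff_distrib scaleR_conv_of_real)
  then have "inner y (field_cnj x * z) = 2 * inner x 1 * inner y z - inner y (x * z)"
    by (simp add: inner_diff_right)
  ultimately show ?thesis by (simp add: inner_commute)
qed

lemma field_cnj_mult_self:
  fixes x :: "'a::{real_normed_field,real_inner}"
  shows "field_cnj x * x = of_real ((norm x)\<^sup>2)"
proof -
  have one: "inner (1::'a) 1 = 1"
    by (simp flip: power2_norm_eq_inner)
  have eq: "inner y (field_cnj x * x) = inner y (of_real ((norm x)\<^sup>2))" for y
  proof -
    have lin1: "inner (x * y) (x * 1) = inner x x * inner y 1"
    proof -
      have sq: "inner (x * v) (x * v) = inner x x * inner v v" for v
        by (simp add: norm_mult power_mult_distrib flip: power2_norm_eq_inner)
      show ?thesis using sq[of "y + 1"] sq[of y] sq[of 1]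
        by (simp add: one algebra_simps inner_add_left inner_add_right inner_commute)
    qed
    have "inner y (of_real ((norm x)\<^sup>2)) = (norm x)\<^sup>2 * inner y 1"
      by (simp add: of_real_def)
    then show ?thesis
      using lin1 inner_mult_left_field_cnj[of x y "x * 1"] by (simp add: power2_norm_eq_inner)
  qed
  define d where "d = field_cnj x * x - of_real ((norm x)\<^sup>2)"
  have "inner d d = 0"
    using eq[of d] unfolding d_def inner_diff_right by simp
  then show ?thesis by (simp add: d_def)
qed

lemma norm_field_cnj [simp]:
  fixes x :: "'a::{real_normed_field,real_inner}"
  shows "norm (field_cnj x) = norm x"
proof (cases "x = 0")
  case True
  then show ?thesis by (simp add: field_cnj_def)
next
  case False
  have "norm (field_cnj x) * norm x = (norm x)\<^sup>2"
    using arg_cong[OF field_cnj_mult_self[of x], of norm] by (simp add: norm_mult norm_power)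
  then show ?thesis using False by (simp add: power2_eq_square)
qed

lemma norm_add_square: "(norm (x + y))\<^sup>2 = (norm x)\<^sup>2 + 2 * inner x y + (norm y)\<^sup>2"
  by (simp add: power2_norm_eq_inner inner_add_left inner_add_right inner_commute)

lemma sum_norm_add_mult_square:
  fixes v u :: "'k \<Rightarrow> 'a::{real_normed_field,real_inner}"
  shows "(\<Sum>k\<in>T. (norm (v k + s * u k))\<^sup>2)
    = (\<Sum>k\<in>T. (norm (v k))\<^sup>2) + 2 * inner s (\<Sum>k\<in>T. field_cnj (u k) * v k)
      + (norm s)\<^sup>2 * (\<Sum>k\<in>T. (norm (u k))\<^sup>2)"
proof -
  have "(norm (v k + s * u k))\<^sup>2
      = (norm (v k))\<^sup>2 + 2 * inner s (field_cnj (u k) * v k) + (norm s)\<^sup>2 * (norm (u k))\<^sup>2" for k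
  proof -
    have "(norm (v k + s * u k))\<^sup>2 = (norm (v k))\<^sup>2 + 2 * inner (u k * s) (v k) + (norm (s * u k))\<^sup>2"
      unfolding norm_add_square by (simp add: inner_commute mult.commute)
    then show ?thesis
      by (simp add: inner_mult_left_field_cnj norm_mult power_mult_distrib)
  qed
  then show ?thesis
    by (simp add: sum.distrib inner_sum_right sum_distrib_left)
qed

lemma norm_sum_mult_le_L2_set:
  fixes u v :: "'k \<Rightarrow> 'a::real_normed_field"
  shows "norm (\<Sum>k\<in>T. u k * v k) \<le> L2_set (\<lambda>k. norm (u k)) T * L2_set (\<lambda>k. norm (v k)) T"
proof -
  have "norm (\<Sum>k\<in>T. u k * v k) \<le> (\<Sum>k\<in>T. \<bar>norm (u k)\<bar> * \<bar>norm (v k)\<bar>)"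
    by (rule order_trans[OF norm_sum]) (simp add: norm_mult)
  also have "\<dots> \<le> L2_set (\<lambda>k. norm (u k)) T * L2_set (\<lambda>k. norm (v k)) T"
    by (rule L2_set_mult_ineq)
  finally show ?thesis .
qed

section \<open>Pivoted Gram--Schmidt orthogonalisation\<close>

text \<open>The squared length of a combination of independent columns is rewritten as
  \<open>\<Sum>s. (D s)\<^sup>2 * (norm (g\<^sub>s x))\<^sup>2\<close>, which is the factorisation \<open>D W\<close>, up to an isometry on the left, of the
  matrix with these columns; here \<open>W\<close> has rows \<open>g\<^sub>s\<close>. Choosing a longest remaining column at each step
  makes every coefficient at most one, and back substitution then bounds the inverse of \<open>W\<close> by a
  factorial. Both bounds are independent of the columns: all ill-conditioning goes into the diagonal
  part \<open>D\<close>.\<close>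

lemma pivoted_gram_schmidt:
  fixes c :: "'i \<Rightarrow> 'k \<Rightarrow> 'a::{real_normed_field,real_inner}"
  assumes "finite T" "finite S"
    and "\<forall>x. (\<forall>k\<in>T. (\<Sum>i\<in>S. x i * c i k) = 0) \<longrightarrow> (\<forall>i\<in>S. x i = 0)"
  shows "\<exists>g D. (\<forall>s\<in>S. 0 < D s) \<and> (\<forall>s\<in>S. \<forall>i\<in>S. norm (g s i) \<le> 1)
    \<and> (\<forall>x. (\<Sum>k\<in>T. (norm (\<Sum>i\<in>S. x i * c i k))\<^sup>2)
           = (\<Sum>s\<in>S. (D s)\<^sup>2 * (norm (\<Sum>i\<in>S. g s i * x i))\<^sup>2))
    \<and> (\<forall>x m. (\<forall>s\<in>S. norm (\<Sum>i\<in>S. g s i * x i) \<le> m)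
           \<longrightarrow> (\<forall>i\<in>S. norm (x i) \<le> fact (card S) * m))"
  using assms(2,3)
proof (induction "card S" arbitrary: S c)
  case 0
  then have "S = {}" by simp
  then show ?case by simp
next
  case (Suc n S c)
  have inj: "x i = 0" if "\<And>k. k \<in> T \<Longrightarrow> (\<Sum>i\<in>S. x i * c i k) = 0" "i \<in> S" for x i
    using Suc.prems(2) that by blast
  define N where "N i = L2_set (\<lambda>k. norm (c i k)) T" for i
  have "S \<noteq> {}" using Suc.hyps(2) by auto
  \<comment> \<open>The pivot is a longest column, so that all projection coefficients have modulus at most one.\<close>
  obtain p where p: "p \<in> S" and max: "\<And>i. i \<in> S \<Longrightarrow> N i \<le> N p"
  proof -
    have "Max (N ` S) \<in> N ` S" using Suc.prems(1) \<open>S \<noteq> {}\<close> by simp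
    then obtain p where "p \<in> S" "N p = Max (N ` S)" by auto
    then show ?thesis using that Suc.prems(1) by (metis Max_ge finite_imageI imageI)
  qed
  define S' where "S' = S - {p}"
  have fin: "finite S'" and card': "n = card S'" and S: "S = insert p S'" "p \<notin> S'"
    using Suc.prems(1) Suc.hyps(2) p by (auto simp: S'_def)
  have sumS: "(\<Sum>i\<in>S. h i) = h p + (\<Sum>i\<in>S'. h i)" for h :: "'i \<Rightarrow> 'a"
    unfolding S(1) using fin S(2) by simp
  have sumR: "(\<Sum>i\<in>S. h i) = h p + (\<Sum>i\<in>S'. h i)" for h :: "'i \<Rightarrow> real"
    unfolding S(1) using fin S(2) by simp
  have Np: "N p > 0"
  proof (rule ccontr)
    assume "\<not> N p > 0"
    then have "N p = 0" unfolding N_def using L2_set_nonneg less_le by metis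
    then have z: "c p k = 0" if "k \<in> T" for k
      unfolding N_def using L2_set_eq_0_iff[OF assms(1)] that by auto
    define x where "x i = (if i = p then 1 else 0 :: 'a)" for i
    have "x p = 0"
    proof (rule inj[OF _ p])
      fix k assume "k \<in> T"
      moreover have "(\<Sum>i\<in>S'. x i * c i k) = 0" by (rule sum.neutral) (use S(2) in \<open>auto simp: x_def\<close>)
      ultimately show "(\<Sum>i\<in>S. x i * c i k) = 0" by (simp add: sumS z)
    qed
    then show False by (simp add: x_def)
  qed
  have Np2: "(N p)\<^sup>2 = (\<Sum>k\<in>T. (norm (c p k))\<^sup>2)"
    by (simp add: N_def L2_set_def sum_nonneg)
  have hpp: "(\<Sum>k\<in>T. field_cnj (c p k) * c p k) = of_real ((N p)\<^sup>2)"
    unfolding Np2 by (simp add: field_cnj_mult_self)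
  define \<phi> where "\<phi> i = (\<Sum>k\<in>T. field_cnj (c p k) * c i k) / of_real ((N p)\<^sup>2)" for i
  have phip: "\<phi> p = 1" using Np by (simp add: \<phi>_def hpp)
  have phi1: "norm (\<phi> i) \<le> 1" if "i \<in> S" for i
  proof -
    have "norm (\<Sum>k\<in>T. field_cnj (c p k) * c i k) \<le> N p * N i"
      using norm_sum_mult_le_L2_set[of "\<lambda>k. field_cnj (c p k)" "c i" T] by (simp add: N_def)
    also have "\<dots> \<le> N p * N p" using max[OF that] Np by simp
    finally show ?thesis using Np by (simp add: \<phi>_def norm_divide norm_mult power2_eq_square)
  qed
  \<comment> \<open>The columns after projection onto the orthogonal complement of the pivot.\<close>
  define c' where "c' i k = c i k - \<phi> i * c p k" for i k
  have orth: "(\<Sum>k\<in>T. field_cnj (c p k) * c' i k) = 0" for i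
  proof -
    have "(\<Sum>k\<in>T. field_cnj (c p k) * c' i k)
        = (\<Sum>k\<in>T. field_cnj (c p k) * c i k) - \<phi> i * (\<Sum>k\<in>T. field_cnj (c p k) * c p k)"
      by (simp add: c'_def algebra_simps sum_subtractf sum_distrib_left)
    then show ?thesis using Np by (simp add: hpp \<phi>_def)
  qed
  have split: "(\<Sum>i\<in>S. x i * c i k) = (\<Sum>i\<in>S'. x i * c' i k) + (\<Sum>i\<in>S. \<phi> i * x i) * c p k" for x k
    by (simp add: sumS phip c'_def algebra_simps sum_subtractf sum_distrib_left sum_distrib_right)
  have inj': "x i = 0" if x: "\<And>k. k \<in> T \<Longrightarrow> (\<Sum>i\<in>S'. x i * c' i k) = 0" and i: "i \<in> S'" for x i
  proof -
    \<comment> \<open>A relation between the projected columns lifts to one between the original columns, with a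
      suitable coefficient at the pivot.\<close>
    define x' where "x' i = (if i = p then - (\<Sum>i\<in>S'. \<phi> i * x i) else x i)" for i
    have eq: "(\<Sum>i\<in>S'. h (x' i) i) = (\<Sum>i\<in>S'. h (x i) i)" for h :: "'a \<Rightarrow> 'i \<Rightarrow> 'a"
      by (rule sum.cong) (use S(2) in \<open>auto simp: x'_def\<close>)
    have "(\<Sum>i\<in>S. \<phi> i * x' i) = 0"
      unfolding sumS eq[of "\<lambda>y i. \<phi> i * y"] by (simp add: phip x'_def)
    then have "(\<Sum>i\<in>S. x' i * c i k) = 0" if "k \<in> T" for k
      unfolding split eq[of "\<lambda>y i. y * c' i k"] using x[OF that] by simp
    then have "x' i = 0" by (rule inj) (use i S in auto)
    then show ?thesis using i S(2) by (auto simp: x'_def split: if_splits)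
  qed
  then have "\<forall>x. (\<forall>k\<in>T. (\<Sum>i\<in>S'. x i * c' i k) = 0) \<longrightarrow> (\<forall>i\<in>S'. x i = 0)" by blast
  then have "\<exists>g D. (\<forall>s\<in>S'. 0 < D s) \<and> (\<forall>s\<in>S'. \<forall>i\<in>S'. norm (g s i) \<le> 1)
    \<and> (\<forall>x. (\<Sum>k\<in>T. (norm (\<Sum>i\<in>S'. x i * c' i k))\<^sup>2)
           = (\<Sum>s\<in>S'. (D s)\<^sup>2 * (norm (\<Sum>i\<in>S'. g s i * x i))\<^sup>2))
    \<and> (\<forall>x m. (\<forall>s\<in>S'. norm (\<Sum>i\<in>S'. g s i * x i) \<le> m)
           \<longrightarrow> (\<forall>i\<in>S'. norm (x i) \<le> fact n * m))"
    unfolding card' by (intro Suc.hyps(1)[OF card' fin])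
  then obtain g' D' where D': "\<forall>s\<in>S'. 0 < D' s"
    and g': "\<forall>s\<in>S'. \<forall>i\<in>S'. norm (g' s i) \<le> 1"
    and eq': "\<forall>x. (\<Sum>k\<in>T. (norm (\<Sum>i\<in>S'. x i * c' i k))\<^sup>2)
           = (\<Sum>s\<in>S'. (D' s)\<^sup>2 * (norm (\<Sum>i\<in>S'. g' s i * x i))\<^sup>2)"
    and bd': "\<forall>x m. (\<forall>s\<in>S'. norm (\<Sum>i\<in>S'. g' s i * x i) \<le> m)
           \<longrightarrow> (\<forall>i\<in>S'. norm (x i) \<le> fact n * m)"
    by (elim exE conjE)
  define g where "g s i = (if s = p then \<phi> i else if i = p then 0 else g' s i)" for s i
  define D where "D s = (if s = p then N p else D' s)" for s
  have gp: "(\<Sum>i\<in>S. g p i * x i) = (\<Sum>i\<in>S. \<phi> i * x i)" for x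
    by (simp add: g_def)
  have gs: "(\<Sum>i\<in>S. g s i * x i) = (\<Sum>i\<in>S'. g' s i * x i)" if "s \<in> S'" for s x
  proof -
    have "s \<noteq> p" using that S(2) by auto
    then have "(\<Sum>i\<in>S'. g s i * x i) = (\<Sum>i\<in>S'. g' s i * x i)"
      by (intro sum.cong) (use S(2) in \<open>auto simp: g_def\<close>)
    then show ?thesis using \<open>s \<noteq> p\<close> by (simp add: sumS g_def)
  qed
  show ?case
  proof (intro exI[of _ g] exI[of _ D] conjI ballI allI impI)
    show "0 < D s" if "s \<in> S" for s using that D' Np S by (auto simp: D_def)
    show "norm (g s i) \<le> 1" if "s \<in> S" "i \<in> S" for s i
      using that g' phi1 S by (auto simp: g_def)
    fix x :: "'i \<Rightarrow> 'a"
    define a where "a = (\<Sum>i\<in>S. \<phi> i * x i)"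
    define y where "y k = (\<Sum>i\<in>S'. x i * c' i k)" for k
    have hy: "(\<Sum>k\<in>T. field_cnj (c p k) * y k) = 0"
    proof -
      have "(\<Sum>k\<in>T. field_cnj (c p k) * y k) = (\<Sum>k\<in>T. \<Sum>i\<in>S'. x i * (field_cnj (c p k) * c' i k))"
        by (simp add: y_def sum_distrib_left mult.left_commute)
      also have "\<dots> = (\<Sum>i\<in>S'. x i * (\<Sum>k\<in>T. field_cnj (c p k) * c' i k))"
        by (subst sum.swap) (simp add: sum_distrib_left)
      finally show ?thesis by (simp add: orth)
    qed
    have "(\<Sum>k\<in>T. (norm (\<Sum>i\<in>S. x i * c i k))\<^sup>2) = (\<Sum>k\<in>T. (norm (y k))\<^sup>2) + (norm a)\<^sup>2 * (N p)\<^sup>2"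
      unfolding split a_def[symmetric] y_def[symmetric] sum_norm_add_mult_square hy Np2 by simp
    also have "(\<Sum>k\<in>T. (norm (y k))\<^sup>2) = (\<Sum>s\<in>S'. (D' s)\<^sup>2 * (norm (\<Sum>i\<in>S'. g' s i * x i))\<^sup>2)"
      unfolding y_def by (rule eq'[rule_format])
    also have "\<dots> = (\<Sum>s\<in>S'. (D s)\<^sup>2 * (norm (\<Sum>i\<in>S. g s i * x i))\<^sup>2)"
      by (intro sum.cong) (use S(2) in \<open>auto simp: gs D_def\<close>)
    finally show "(\<Sum>k\<in>T. (norm (\<Sum>i\<in>S. x i * c i k))\<^sup>2)
        = (\<Sum>s\<in>S. (D s)\<^sup>2 * (norm (\<Sum>i\<in>S. g s i * x i))\<^sup>2)"
      unfolding sumR gp a_def by (simp add: D_def mult.commute)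
  next
    fix x :: "'i \<Rightarrow> 'a" and m :: real and i
    assume b: "\<forall>s\<in>S. norm (\<Sum>i\<in>S. g s i * x i) \<le> m" and i: "i \<in> S"
    have a: "norm (\<Sum>i\<in>S. \<phi> i * x i) \<le> m" using b p gp by metis
    have m: "0 \<le> m" using a norm_ge_zero order_trans by blast
    have b': "norm (x i) \<le> fact n * m" if "i \<in> S'" for i
      using bd'[rule_format, OF _ that, of x m] b gs S by auto
    have card: "card S = Suc n" using Suc.hyps(2) by simp
    show "norm (x i) \<le> fact (card S) * m"
    proof (cases "i = p")
      case False
      then have "norm (x i) \<le> fact n * m" using b' i S by auto
      also have "\<dots> \<le> fact (Suc n) * m" by (intro mult_right_mono fact_mono m) auto
      finally show ?thesis by (simp add: card)
    next
      case True
      have "x p = (\<Sum>i\<in>S. \<phi> i * x i) - (\<Sum>i\<in>S'. \<phi> i * x i)" by (simp add: sumS phip)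
      then have "norm (x p) \<le> norm (\<Sum>i\<in>S. \<phi> i * x i) + norm (\<Sum>i\<in>S'. \<phi> i * x i)"
        by (simp add: norm_triangle_ineq4)
      also have "norm (\<Sum>i\<in>S'. \<phi> i * x i) \<le> (\<Sum>i\<in>S'. 1 * (fact n * m))"
        by (rule order_trans[OF norm_sum sum_mono], unfold norm_mult)
           (intro mult_mono, use b' phi1 S in auto)
      also have "\<dots> = real n * (fact n * m)" by (simp flip: card')
      finally have "norm (x p) \<le> m + real n * (fact n * m)" using a by linarith
      also have "\<dots> \<le> fact n * m + real n * (fact n * m)"
        using mult_right_mono[OF fact_ge_1[of n, where 'a = real] m] by simp
      also have "\<dots> = fact (card S) * m" by (simp add: card algebra_simps)
      finally show ?thesis using True by simp
    qed
  qed
qed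

section \<open>A nearly optimal quadratic form\<close>

text \<open>Sylvester's identity. The two sides are the determinants of \<open>L X\<close> and \<open>X L\<close> for the block
  matrices with rows \<open>(1, 0), (U, 1)\<close> and \<open>(1, V), (- U, 1)\<close>.\<close>

lemma det_one_plus_mult_commute:
  fixes U V :: "'a::idom mat"
  assumes U: "U \<in> carrier_mat n m" and V: "V \<in> carrier_mat m n"
  shows "det (1\<^sub>m n + U * V) = det (1\<^sub>m m + V * U)"
proof -
  define L where "L = four_block_mat (1\<^sub>m m) (0\<^sub>m m n) U (1\<^sub>m n)"
  define X where "X = four_block_mat (1\<^sub>m m) V (- U) (1\<^sub>m n)"
  have c: "L \<in> carrier_mat (m + n) (m + n)" "X \<in> carrier_mat (m + n) (m + n)"
    using U V by (auto simp: L_def X_def)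
  have nU: "- U \<in> carrier_mat n m" using U by simp
  have "det L = 1"
    unfolding L_def by (subst det_four_block_mat_upper_right_zero[OF _ _ U]) auto
  have "L * X = four_block_mat (1\<^sub>m m * 1\<^sub>m m + 0\<^sub>m m n * - U) (1\<^sub>m m * V + 0\<^sub>m m n * 1\<^sub>m n)
      (U * 1\<^sub>m m + 1\<^sub>m n * - U) (U * V + 1\<^sub>m n * 1\<^sub>m n)"
    unfolding L_def X_def by (rule mult_four_block_mat[OF _ _ U _ _ V nU]) auto
  also have "\<dots> = four_block_mat (1\<^sub>m m) V (0\<^sub>m n m) (1\<^sub>m n + U * V)"
  proof -
    have "U * 1\<^sub>m m + 1\<^sub>m n * - U = 0\<^sub>m n m" using U by auto
    moreover have "U * V + 1\<^sub>m n * 1\<^sub>m n = 1\<^sub>m n + U * V"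
      using U V by (simp add: comm_add_mat[of _ n n])
    moreover have "1\<^sub>m m * 1\<^sub>m m + 0\<^sub>m m n * - U = 1\<^sub>m m" "1\<^sub>m m * V + 0\<^sub>m m n * 1\<^sub>m n = V"
      using nU V by auto
    ultimately show ?thesis by simp
  qed
  finally have "det (L * X) = det (1\<^sub>m n + U * V)"
    using det_four_block_mat_lower_left_zero[OF one_carrier_mat V refl, of "1\<^sub>m n + U * V"] U V by simp
  moreover have "X * L = four_block_mat (1\<^sub>m m * 1\<^sub>m m + V * U) (1\<^sub>m m * 0\<^sub>m m n + V * 1\<^sub>m n)
      (- U * 1\<^sub>m m + 1\<^sub>m n * U) (- U * 0\<^sub>m m n + 1\<^sub>m n * 1\<^sub>m n)"
    unfolding L_def X_def by (rule mult_four_block_mat[OF _ V nU _ _ _ U]) auto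
  moreover have "\<dots> = four_block_mat (1\<^sub>m m + V * U) V (0\<^sub>m n m) (1\<^sub>m n)"
  proof -
    have "- U * 1\<^sub>m m + 1\<^sub>m n * U = 0\<^sub>m n m" using U by auto
    moreover have "1\<^sub>m m * 0\<^sub>m m n + V * 1\<^sub>m n = V" "- U * 0\<^sub>m m n + 1\<^sub>m n * 1\<^sub>m n = 1\<^sub>m n"
      using nU V by auto
    ultimately show ?thesis by simp
  qed
  ultimately have "det (X * L) = det (1\<^sub>m m + V * U)"
    using det_four_block_mat_lower_left_zero[OF _ V refl one_carrier_mat, of "1\<^sub>m m + V * U"] U V by simp
  then show ?thesis
    using \<open>det (L * X) = _\<close> det_mult[OF c] det_mult[OF c(2,1)] by (simp add: mult.commute)
qed

lemma det_rank_one_update: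
  fixes u v :: "'a::idom vec"
  assumes u: "u \<in> carrier_vec n" and v: "v \<in> carrier_vec n"
  shows "det (1\<^sub>m n + mat n n (\<lambda>(i, j). u $ i * v $ j)) = 1 + (\<Sum>i<n. v $ i * u $ i)"
proof -
  define U where "U = mat n 1 (\<lambda>(i, j). u $ i)"
  define V where "V = mat 1 n (\<lambda>(i, j). v $ j)"
  have c: "U \<in> carrier_mat n 1" "V \<in> carrier_mat 1 n" by (auto simp: U_def V_def)
  have "mat n n (\<lambda>(i, j). u $ i * v $ j) = U * V"
    by (rule eq_matI) (auto simp: U_def V_def scalar_prod_def)
  moreover have "det (1\<^sub>m 1 + V * U) = (1\<^sub>m 1 + V * U) $$ (0, 0)"
    by (rule det_single) (use c in simp)
  moreover have "(1\<^sub>m 1 + V * U) $$ (0, 0) = 1 + (\<Sum>i<n. v $ i * u $ i)"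
    by (auto simp: U_def V_def scalar_prod_def lessThan_atLeast0 intro!: sum.cong)
  ultimately show ?thesis using det_one_plus_mult_commute[OF c] by simp
qed

lemma euclidean_norm_vec_square: "(euclidean_norm_vec v)\<^sup>2 = (\<Sum>i<dim_vec v. (norm (v $ i))\<^sup>2)"
  by (simp add: euclidean_norm_vec_def L2_set_def sum_nonneg)

lemma norm_scalar_prod_le:
  fixes f x :: "'a::real_normed_field vec"
  assumes "f \<in> carrier_vec n" "x \<in> carrier_vec n"
  shows "norm (f \<bullet> x) \<le> euclidean_norm_vec f * euclidean_norm_vec x"
  using norm_sum_mult_le_L2_set[of "\<lambda>i. f $ i" "\<lambda>i. x $ i" "{..<n}"] assms
  by (simp add: scalar_prod_def euclidean_norm_vec_def lessThan_atLeast0)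

lemma norm_det_le:
  fixes A :: "'a::real_normed_field mat"
  assumes A: "A \<in> carrier_mat n n"
    and b: "\<And>i j. i < n \<Longrightarrow> j < n \<Longrightarrow> norm (A $$ (i, j)) \<le> C"
  shows "norm (det A) \<le> real (card {p. p permutes {0..<n}}) * C ^ n"
proof -
  have "norm (det A) \<le> (\<Sum>p\<in>{p. p permutes {0..<n}}. C ^ n)"
  proof -
    have "norm (signof p * (\<Prod>i=0..<n. A $$ (i, p i))) \<le> C ^ n" if p: "p permutes {0..<n}" for p
    proof -
      have "norm (signof p :: 'a) = 1" by (simp add: sign_def)
      then have "norm (signof p * (\<Prod>i=0..<n. A $$ (i, p i))) = (\<Prod>i=0..<n. norm (A $$ (i, p i)))"
        by (simp add: norm_mult prod_norm)
      also have "\<dots> \<le> (\<Prod>i=0..<n. C)"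
      proof (rule prod_mono)
        fix i assume i: "i \<in> {0..<n}"
        then have "p i < n" using permutes_in_image[OF p, of i] by simp
        then show "0 \<le> norm (A $$ (i, p i)) \<and> norm (A $$ (i, p i)) \<le> C" using b i by simp
      qed
      finally show ?thesis by simp
    qed
    then show ?thesis unfolding det_def'[OF A]
      by (intro order_trans[OF norm_sum] sum_mono) auto
  qed
  then show ?thesis by simp
qed

text \<open>An operator that shrinks the hyperplane where \<open>v\<close> vanishes by \<open>sqrt (1 - l)\<close> and stretches the
  conjugate direction so that the new form is a convex combination of the old one and of
  \<open>(norm (v \<bullet> y))\<^sup>2\<close>. The operator is \<open>a + k \<cdot> cnj v v\<^sup>T\<close>, with \<open>a\<close> and \<open>b\<close> the scaling factors on the hyperplane
  and along \<open>cnj v\<close>.\<close>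

lemma rank_one_stretch:
  fixes v :: "'a::{real_normed_field,real_inner} vec"
  assumes v: "v \<in> carrier_vec n" and n: "n \<ge> 1" and v0: "euclidean_norm_vec v > 0"
    and l: "0 < l" "l < 1"
  obtains M where "M \<in> carrier_mat n n"
    "\<And>y. y \<in> carrier_vec n \<Longrightarrow>
      (euclidean_norm_vec (M *\<^sub>v y))\<^sup>2 = (1 - l) * (euclidean_norm_vec y)\<^sup>2 + l * (norm (v \<bullet> y))\<^sup>2"
    "(norm (det M))\<^sup>2 = (1 - l) ^ (n - 1) * (1 - l + l * (euclidean_norm_vec v)\<^sup>2)"
proof -
  define r where "r = (euclidean_norm_vec v)\<^sup>2"
  have r: "r > 0" using v0 by (simp add: r_def)
  have r_sum: "r = (\<Sum>i<n. (norm (v $ i))\<^sup>2)" using v by (simp add: r_def euclidean_norm_vec_square)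
  define a where "a = sqrt (1 - l)"
  define b where "b = sqrt (1 - l + l * r)"
  have a: "a > 0" "a\<^sup>2 = 1 - l" using l by (auto simp: a_def)
  have b: "b > 0" "b\<^sup>2 = 1 - l + l * r"
    using l r by (auto simp: b_def add_pos_pos less_imp_le)
  define k where "k = (b - a) / r"
  have kr: "k * r = b - a" using r by (simp add: k_def)
  define u where "u = vec n (\<lambda>i. of_real (k / a) * field_cnj (v $ i))"
  have u: "u \<in> carrier_vec n" by (simp add: u_def)
  define M where "M = of_real a \<cdot>\<^sub>m (1\<^sub>m n + mat n n (\<lambda>(i, j). u $ i * v $ j))"
  have M: "M \<in> carrier_mat n n" by (simp add: M_def)
  have My: "(M *\<^sub>v y) $ i = of_real a * y $ i + (of_real k * (v \<bullet> y)) * field_cnj (v $ i)"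
    if y: "y \<in> carrier_vec n" and i: "i < n" for y i
  proof -
    have "(M *\<^sub>v y) $ i = (\<Sum>j<n. of_real a * ((if i = j then 1 else 0) + u $ i * v $ j) * y $ j)"
      unfolding mult_mat_vec_index[OF M y i]
      by (rule sum.cong) (use i in \<open>auto simp: M_def\<close>)
    also have "\<dots> = (\<Sum>j<n. (if i = j then of_real a * y $ j else 0))
        + (\<Sum>j<n. of_real a * u $ i * (v $ j * y $ j))"
      unfolding sum.distrib[symmetric] by (rule sum.cong) (auto simp: algebra_simps)
    also have "(\<Sum>j<n. (if i = j then of_real a * y $ j else 0)) = of_real a * y $ i"
      using i by simp
    also have "(\<Sum>j<n. of_real a * u $ i * (v $ j * y $ j)) = of_real a * u $ i * (v \<bullet> y)"
      using y by (simp add: scalar_prod_def sum_distrib_left lessThan_atLeast0)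
    also have "of_real a * u $ i = of_real k * field_cnj (v $ i)"
      using a i by (simp add: u_def)
    finally show ?thesis by (simp add: mult_ac)
  qed
  have norm_My: "(euclidean_norm_vec (M *\<^sub>v y))\<^sup>2
      = (1 - l) * (euclidean_norm_vec y)\<^sup>2 + l * (norm (v \<bullet> y))\<^sup>2"
    if y: "y \<in> carrier_vec n" for y
  proof -
    define s where "s = v \<bullet> y"
    have s_sum: "s = (\<Sum>i<n. v $ i * y $ i)"
      using y by (simp add: s_def scalar_prod_def lessThan_atLeast0)
    have inner: "inner (of_real a * x) ((of_real k * s) * field_cnj z) = a * k * inner (z * x) s" for x z :: 'a
    proof -
      have "of_real a * x = a *\<^sub>R x" "(of_real k * s) * field_cnj z = k *\<^sub>R (field_cnj z * s)"
        by (simp_all add: scaleR_conv_of_real mult_ac)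
      then show ?thesis by (simp add: inner_mult_left_field_cnj)
    qed
    have "(euclidean_norm_vec (M *\<^sub>v y))\<^sup>2
        = (\<Sum>i<n. (norm (of_real a * y $ i + (of_real k * s) * field_cnj (v $ i)))\<^sup>2)"
      using M My[OF y] by (simp add: euclidean_norm_vec_square s_def)
    also have "\<dots> = (\<Sum>i<n. a\<^sup>2 * (norm (y $ i))\<^sup>2 + 2 * (a * k * inner (v $ i * y $ i) s)
        + k\<^sup>2 * (norm s)\<^sup>2 * (norm (v $ i))\<^sup>2)"
    proof (rule sum.cong[OF refl])
      fix i
      show "(norm (of_real a * y $ i + (of_real k * s) * field_cnj (v $ i)))\<^sup>2
        = a\<^sup>2 * (norm (y $ i))\<^sup>2 + 2 * (a * k * inner (v $ i * y $ i) s) + k\<^sup>2 * (norm s)\<^sup>2 * (norm (v $ i))\<^sup>2"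
        unfolding inner[symmetric] norm_add_square by (simp add: norm_mult power_mult_distrib)
    qed
    also have "\<dots> = a\<^sup>2 * (\<Sum>i<n. (norm (y $ i))\<^sup>2) + 2 * (a * k * inner s s) + k\<^sup>2 * (norm s)\<^sup>2 * r"
      unfolding sum.distrib r_sum sum_distrib_left[symmetric] inner_sum_left[symmetric] s_sum[symmetric] ..
    also have "\<dots> = a\<^sup>2 * (euclidean_norm_vec y)\<^sup>2 + k * (2 * a + k * r) * (norm s)\<^sup>2"
    proof -
      have "(\<Sum>i<n. (norm (y $ i))\<^sup>2) = (euclidean_norm_vec y)\<^sup>2"
        using y by (simp add: euclidean_norm_vec_square)
      then show ?thesis
        by (simp only: power2_norm_eq_inner[symmetric]) (simp add: power2_eq_square[of k] algebra_simps)
    qed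
    also have "k * (2 * a + k * r) = l"
    proof -
      have "k * (2 * a + k * r) * r = (k * r) * (2 * a + k * r)" by simp
      also have "\<dots> = b\<^sup>2 - a\<^sup>2" unfolding kr by (simp add: power2_eq_square algebra_simps)
      also have "\<dots> = l * r" by (simp add: a b)
      finally show ?thesis using r by simp
    qed
    finally show ?thesis by (simp add: a s_def)
  qed
  have "det M = of_real a ^ n * (1 + (\<Sum>i<n. v $ i * u $ i))"
    unfolding M_def by (subst det_smult) (simp add: det_rank_one_update[OF u v])
  also have "(\<Sum>i<n. v $ i * u $ i) = (\<Sum>i<n. of_real (k / a) * of_real ((norm (v $ i))\<^sup>2))"
  proof (rule sum.cong[OF refl])
    fix i assume "i \<in> {..<n}"
    then show "v $ i * u $ i = of_real (k / a) * of_real ((norm (v $ i))\<^sup>2)"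
      unfolding field_cnj_mult_self[symmetric] by (simp add: u_def mult_ac)
  qed
  also have "\<dots> = of_real (k / a * r)"
    unfolding r_sum by (simp add: sum_distrib_left)
  also have "of_real a ^ n * (1 + of_real (k / a * r)) = (of_real (a ^ n * (1 + k / a * r)) :: 'a)"
    by simp
  also have "a ^ n * (1 + k / a * r) = a ^ (n - 1) * b"
  proof -
    have "a ^ n = a ^ (n - 1) * a" using n by (cases n) simp_all
    moreover have "a * (1 + k / a * r) = b" using a kr by (simp add: field_simps)
    ultimately show ?thesis by simp
  qed
  finally have "(norm (det M))\<^sup>2 = (a ^ (n - 1) * b)\<^sup>2"
    by (simp only: norm_of_real power2_abs)
  also have "\<dots> = (a\<^sup>2) ^ (n - 1) * b\<^sup>2"
    unfolding power_mult_distrib power_mult[symmetric] mult.commute[of 2] ..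
  finally have "(norm (det M))\<^sup>2 = (1 - l) ^ (n - 1) * (1 - l + l * r)" by (simp only: a b)
  then show ?thesis using that[OF M norm_My] by (simp add: r_def)
qed

text \<open>To first order in \<open>l\<close> the squared volume factor of the rank-one stretch is \<open>1 + l * (r - n)\<close>, so it exceeds one as soon as \<open>r > n\<close>.
  The explicit \<open>l\<close> makes the second-order term at most half of the first-order one, which gives a
  gain depending only on \<open>n\<close> and \<open>\<delta>\<close>.\<close>

lemma stretch_gain:
  fixes \<delta> r :: real
  assumes n: "n \<ge> 1" and d: "\<delta> > 0" and r: "r \<ge> real n + \<delta>"
  defines "l \<equiv> \<delta> / (2 * real n * (real n + \<delta>))"
  shows "0 < l" "l < 1" "1 + l * \<delta> / 2 \<le> (1 - l) ^ (n - 1) * (1 - l + l * r)"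
proof -
  have n1: "real n \<ge> 1" using n by simp
  show l0: "0 < l" using n1 d by (simp add: l_def)
  have "2 * real n * (real n + \<delta>) \<noteq> 0" using n1 d by simp
  then have "l * (2 * real n * (real n + \<delta>)) = \<delta>" using nonzero_eq_divide_eq l_def by metis
  then have nl: "2 * (real n * l) * (real n + \<delta>) = \<delta>" by (simp only: mult_ac)
  have nl1: "real n * l \<le> 1 / 2"
  proof (rule ccontr)
    assume "\<not> real n * l \<le> 1 / 2"
    then have "1 * (real n + \<delta>) < (2 * (real n * l)) * (real n + \<delta>)"
      using d n1 by (intro mult_strict_right_mono) auto
    then have "real n + \<delta> < \<delta>" unfolding nl by simp
    then show False using n1 by simp
  qed
  have lnl: "l \<le> real n * l" using n1 l0 by simp
  then show l1: "l < 1" using nl1 by linarith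
  define N where "N = real n - 1"
  have N: "0 \<le> N" "real (n - 1) = N" using n by (auto simp: N_def)
  have "(1 - N * l) * (1 + l * (N + \<delta>)) \<le> (1 - l) ^ (n - 1) * (1 - l + l * r)"
  proof (rule mult_mono)
    show "1 - N * l \<le> (1 - l) ^ (n - 1)"
      using Bernoulli_inequality[of "- l" "n - 1"] l1 unfolding N by simp
    have "l * (real n + \<delta>) \<le> l * r" using r l0 by simp
    then show "1 + l * (N + \<delta>) \<le> 1 - l + l * r" by (simp add: N_def algebra_simps)
    show "0 \<le> 1 + l * (N + \<delta>)" using N l0 d by simp
  qed (use l1 in auto)
  moreover have "1 + l * \<delta> / 2 \<le> (1 - N * l) * (1 + l * (N + \<delta>))"
  proof -
    have "N * l * (N + \<delta>) \<le> (real n * l) * (real n + \<delta>)"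
      using l0 d N by (intro mult_mono) (auto simp: N_def)
    also have "\<dots> = \<delta> / 2" using nl by linarith
    finally have "l * (N * l * (N + \<delta>)) \<le> l * (\<delta> / 2)" by (rule mult_left_mono) (use l0 in simp)
    moreover have "(1 - N * l) * (1 + l * (N + \<delta>)) = 1 + l * \<delta> - l * (N * l * (N + \<delta>))"
      by (simp add: algebra_simps)
    moreover have "l * (\<delta> / 2) = l * \<delta> / 2" by simp
    ultimately show ?thesis by linarith
  qed
  ultimately show "1 + l * \<delta> / 2 \<le> (1 - l) ^ (n - 1) * (1 - l + l * r)" by linarith
qed

text \<open>The ellipsoid theorem of John, in the dual form of Kiefer and Wolfowitz and up to \<open>\<delta>\<close>. The set \<open>F\<close> defines
  the norm \<open>sup\<^sub>f norm (f \<bullet> x)\<close>; the conclusion says that a Euclidean norm lies between it and its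
  quotient by \<open>sqrt (n + \<delta>)\<close>. Among the operators \<open>R\<close> whose Euclidean norm stays below the given one
  (the feasible ones) take one with nearly maximal determinant. If some \<open>f\<close> in \<open>F\<close> were longer than
  \<open>sqrt (n + \<delta>)\<close> in the dual norm of \<open>R\<close>, stretching \<open>R\<close> along \<open>f\<close> would stay feasible and raise the
  determinant by a definite factor.\<close>

lemma nearly_optimal_form:
  fixes F :: "'a::{real_normed_field,real_inner} vec set"
  assumes n: "n \<ge> 1" and F: "F \<subseteq> carrier_vec n"
    and unit: "\<And>i. i < n \<Longrightarrow> unit_vec n i \<in> F"
    and bounded: "\<And>f i. f \<in> F \<Longrightarrow> i < n \<Longrightarrow> norm (f $ i) \<le> C"
    and d: "\<delta> > 0"
  obtains R where "R \<in> carrier_mat n n" "det R \<noteq> 0"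
    "\<And>x c. x \<in> carrier_vec n \<Longrightarrow> 0 \<le> c \<Longrightarrow> (\<And>f. f \<in> F \<Longrightarrow> norm (f \<bullet> x) \<le> c)
      \<Longrightarrow> euclidean_norm_vec (R *\<^sub>v x) \<le> c"
    "\<And>f x. f \<in> F \<Longrightarrow> x \<in> carrier_vec n \<Longrightarrow>
      norm (f \<bullet> x) \<le> sqrt (real n + \<delta>) * euclidean_norm_vec (R *\<^sub>v x)"
proof -
  define feasible where "feasible = {R \<in> carrier_mat n n. \<forall>x\<in>carrier_vec n. \<forall>c\<ge>0.
    (\<forall>f\<in>F. norm (f \<bullet> x) \<le> c) \<longrightarrow> euclidean_norm_vec (R *\<^sub>v x) \<le> c}"
  have C: "0 \<le> C" using bounded[OF unit[of 0], of 0] n norm_ge_zero order_trans by fastforce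
  have entry: "norm (R $$ (i, j)) \<le> C" if R: "R \<in> feasible" and ij: "i < n" "j < n" for R i j
  proof -
    have Rc: "R \<in> carrier_mat n n" using R by (simp add: feasible_def)
    have "norm (f \<bullet> unit_vec n j) \<le> C" if "f \<in> F" for f
      using that F bounded ij by (subst scalar_prod_right_unit) auto
    then have "euclidean_norm_vec (R *\<^sub>v unit_vec n j) \<le> C" using R C by (simp add: feasible_def)
    moreover have "norm ((R *\<^sub>v unit_vec n j) $ i) \<le> euclidean_norm_vec (R *\<^sub>v unit_vec n j)"
      unfolding euclidean_norm_vec_def
      by (rule member_le_L2_set[where f = "\<lambda>i. norm ((R *\<^sub>v unit_vec n j) $ i)"]) (use Rc ij in auto)
    moreover have "(R *\<^sub>v unit_vec n j) $ i = R $$ (i, j)"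
      using Rc ij by (simp add: scalar_prod_right_unit)
    ultimately show ?thesis by simp
  qed
  have bdd: "bdd_above ((\<lambda>R. norm (det R)) ` feasible)"
    by (rule bdd_aboveI2, rule norm_det_le[where n = n and C = C])
       (use entry in \<open>auto simp: feasible_def\<close>)
  define s where "s = (SUP R\<in>feasible. norm (det R))"
  \<comment> \<open>Feasible because \<open>F\<close> contains the coordinate functionals; it shows that the
    supremum of the determinants is positive.\<close>
  define R0 where "R0 = (of_real (1 / sqrt (real n)) :: 'a) \<cdot>\<^sub>m 1\<^sub>m n"
  have "R0 \<in> carrier_mat n n" by (simp add: R0_def)
  have R0: "R0 \<in> feasible"
    unfolding feasible_def
  proof (intro CollectI conjI ballI allI impI)
    show "R0 \<in> carrier_mat n n" by (simp add: R0_def)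
    fix x :: "'a vec" and c :: real
    assume x: "x \<in> carrier_vec n" and c: "0 \<le> c" and f: "\<forall>f\<in>F. norm (f \<bullet> x) \<le> c"
    have R0x: "R0 *\<^sub>v x = of_real (1 / sqrt (real n)) \<cdot>\<^sub>v x"
    proof (rule eq_vecI)
      fix i assume "i < dim_vec (of_real (1 / sqrt (real n)) \<cdot>\<^sub>v x)"
      then have i: "i < n" using x by simp
      have "(R0 *\<^sub>v x) $ i = (\<Sum>j<n. if i = j then of_real (1 / sqrt (real n)) * x $ j else 0)"
        unfolding mult_mat_vec_index[OF \<open>R0 \<in> carrier_mat n n\<close> x i]
        by (rule sum.cong) (use i in \<open>auto simp: R0_def\<close>)
      then show "(R0 *\<^sub>v x) $ i = (of_real (1 / sqrt (real n)) \<cdot>\<^sub>v x) $ i" using i x by simp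
    qed (use x in \<open>simp add: R0_def\<close>)
    have "(euclidean_norm_vec x)\<^sup>2 \<le> (\<Sum>i<n. c\<^sup>2)"
    proof -
      have "norm (x $ i) \<le> c" if "i < n" for i
        using f unit[OF that] x that by (auto simp: scalar_prod_left_unit dest!: bspec)
      then have "(\<Sum>i<n. (norm (x $ i))\<^sup>2) \<le> (\<Sum>i<n. c\<^sup>2)" by (intro sum_mono power_mono) auto
      then show ?thesis using x by (simp add: euclidean_norm_vec_square)
    qed
    also have "\<dots> = (sqrt (real n) * c)\<^sup>2" by (simp add: power_mult_distrib)
    finally have "euclidean_norm_vec x \<le> sqrt (real n) * c"
      by (rule power2_le_imp_le) (use c in simp)
    then show "euclidean_norm_vec (R0 *\<^sub>v x) \<le> c"
      using n by (simp add: R0x euclidean_norm_vec_smult norm_divide field_simps)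
  qed
  have "det R0 \<noteq> 0" using n by (simp add: R0_def)
  then have s: "s > 0" unfolding s_def
    using order_less_le_trans[OF _ cSUP_upper[OF R0 bdd]] by simp
  define l where "l = \<delta> / (2 * real n * (real n + \<delta>))"
  \<comment> \<open>The guaranteed gain in the squared determinant; \<open>R\<close> misses the supremum by less
    than this factor.\<close>
  define q where "q = 1 + l * \<delta> / 2"
  have l: "0 < l" "l < 1" using stretch_gain(1,2)[OF n d order_refl] by (auto simp: l_def)
  have q: "q > 1" using l d by (simp add: q_def)
  have "s / sqrt q < s" using s q by (simp add: field_simps)
  then obtain R where R: "R \<in> feasible" and sR: "s / sqrt q < norm (det R)"
    unfolding s_def using less_cSUP_iff[OF _ bdd] R0 by blast
  have Rc: "R \<in> carrier_mat n n" using R by (simp add: feasible_def)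
  have "0 \<le> s / sqrt q" using s q by simp
  then have detR: "det R \<noteq> 0" using sR by auto
  have sR2: "s\<^sup>2 < q * (norm (det R))\<^sup>2"
  proof -
    have "s < sqrt q * norm (det R)" using sR q by (simp add: field_simps)
    then have "s\<^sup>2 < (sqrt q * norm (det R))\<^sup>2" using s by (intro power_strict_mono) auto
    then show ?thesis using q by (simp add: power_mult_distrib)
  qed
  obtain Q where Q: "Q \<in> carrier_mat n n" "Q * R = 1\<^sub>m n"
    using det_non_zero_imp_unit[OF Rc detR, of "()"]
    by (auto simp: Units_def ring_mat_def)
  have bound: "norm (f \<bullet> x) \<le> sqrt (real n + \<delta>) * euclidean_norm_vec (R *\<^sub>v x)"
    if f: "f \<in> F" and x: "x \<in> carrier_vec n" for f x
  proof (rule ccontr)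
    assume neg: "\<not> ?thesis"
    have fc: "f \<in> carrier_vec n" using f F by blast
    \<comment> \<open>The functional \<open>f\<close> read in the coordinates \<open>y = R x\<close>.\<close>
    define v where "v = transpose_mat Q *\<^sub>v f"
    have v: "v \<in> carrier_vec n" using Q fc by (simp add: v_def)
    have vR: "v \<bullet> (R *\<^sub>v z) = f \<bullet> z" if z: "z \<in> carrier_vec n" for z
    proof -
      have "v \<bullet> (R *\<^sub>v z) = f \<bullet> (Q *\<^sub>v (R *\<^sub>v z))"
        unfolding v_def using transpose_vec_mult_scalar[of Q n n "R *\<^sub>v z" f] Q Rc z fc
        by (simp add: comm_scalar_prod[of _ n])
      also have "Q *\<^sub>v (R *\<^sub>v z) = z"
        using assoc_mult_mat_vec[OF Q(1) Rc z] Q z by simp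
      finally show ?thesis .
    qed
    have "sqrt (real n + \<delta>) * euclidean_norm_vec (R *\<^sub>v x) < euclidean_norm_vec v * euclidean_norm_vec (R *\<^sub>v x)"
      using neg norm_scalar_prod_le[OF v, of "R *\<^sub>v x"] Rc x vR[OF x] by simp
    then have vn: "sqrt (real n + \<delta>) < euclidean_norm_vec v"
      by (rule mult_right_less_imp_less) simp
    then have r: "real n + \<delta> \<le> (euclidean_norm_vec v)\<^sup>2"
      by (rule sqrt_le_D[OF less_imp_le])
    have v0: "euclidean_norm_vec v > 0"
      using vn d by (smt (verit) real_sqrt_ge_zero of_nat_0_le_iff)
    obtain M where M: "M \<in> carrier_mat n n"
      and My: "\<And>y. y \<in> carrier_vec n \<Longrightarrow> (euclidean_norm_vec (M *\<^sub>v y))\<^sup>2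
          = (1 - l) * (euclidean_norm_vec y)\<^sup>2 + l * (norm (v \<bullet> y))\<^sup>2"
      and dM: "(norm (det M))\<^sup>2 = (1 - l) ^ (n - 1) * (1 - l + l * (euclidean_norm_vec v)\<^sup>2)"
      using rank_one_stretch[OF v n v0 l] by blast
    have "M * R \<in> feasible"
      unfolding feasible_def
    proof (intro CollectI conjI ballI allI impI)
      show "M * R \<in> carrier_mat n n" using M Rc by simp
      fix z :: "'a vec" and c :: real
      assume z: "z \<in> carrier_vec n" and c: "0 \<le> c" and fz: "\<forall>f\<in>F. norm (f \<bullet> z) \<le> c"
      have "(euclidean_norm_vec ((M * R) *\<^sub>v z))\<^sup>2
          = (1 - l) * (euclidean_norm_vec (R *\<^sub>v z))\<^sup>2 + l * (norm (f \<bullet> z))\<^sup>2"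
        using My[of "R *\<^sub>v z"] vR[OF z] assoc_mult_mat_vec[OF M Rc z] Rc z by simp
      also have "\<dots> \<le> (1 - l) * c\<^sup>2 + l * c\<^sup>2"
        using R z c fz f l by (intro add_mono mult_left_mono power_mono) (auto simp: feasible_def)
      finally have "(euclidean_norm_vec ((M * R) *\<^sub>v z))\<^sup>2 \<le> c\<^sup>2" by (simp add: algebra_simps)
      then show "euclidean_norm_vec ((M * R) *\<^sub>v z) \<le> c" using c by (rule power2_le_imp_le)
    qed
    then have "norm (det (M * R)) \<le> s" unfolding s_def by (rule cSUP_upper[OF _ bdd])
    then have "(norm (det M))\<^sup>2 * (norm (det R))\<^sup>2 \<le> s\<^sup>2"
      unfolding det_mult[OF M Rc] norm_mult power_mult_distrib[symmetric] by (intro power_mono) auto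
    moreover have "q \<le> (norm (det M))\<^sup>2"
      unfolding dM q_def l_def by (rule stretch_gain(3)[OF n d r])
    then have "q * (norm (det R))\<^sup>2 \<le> (norm (det M))\<^sup>2 * (norm (det R))\<^sup>2"
      by (rule mult_right_mono) simp
    ultimately show False using sR2 by linarith
  qed
  show ?thesis
    by (rule that[OF Rc detR _ bound]) (use R in \<open>auto simp: feasible_def\<close>)
qed

section \<open>Coordinates adapted to a given growth rate\<close>

lemma ex_inverse_mat:
  fixes A :: "'a::field mat"
  assumes A: "A \<in> carrier_mat n n" and d: "det A \<noteq> 0"
  obtains B where "B \<in> carrier_mat n n" "A * B = 1\<^sub>m n" "B * A = 1\<^sub>m n"
  using det_non_zero_imp_unit[OF A d, of "()"] that by (auto simp: Units_def ring_mat_def)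

lemma norm_entry_le_spectral_norm:
  fixes A :: "'a::real_normed_field mat"
  assumes A: "A \<in> carrier_mat n n" and ij: "i < n" "j < n"
  shows "norm (A $$ (i, j)) \<le> spectral_norm A"
proof -
  have "norm ((A *\<^sub>v unit_vec n j) $ i) \<le> euclidean_norm_vec (A *\<^sub>v unit_vec n j)"
    unfolding euclidean_norm_vec_def
    by (rule member_le_L2_set[where f = "\<lambda>i. norm ((A *\<^sub>v unit_vec n j) $ i)"]) (use A ij in auto)
  also have "\<dots> \<le> spectral_norm A * euclidean_norm_vec (unit_vec n j :: 'a vec)"
    by (rule euclidean_norm_mult_le_spectral_norm[OF A]) simp
  also have "euclidean_norm_vec (unit_vec n j :: 'a vec) = 1"
  proof -
    have "(\<Sum>i<n. (norm ((unit_vec n j :: 'a vec) $ i))\<^sup>2) = (\<Sum>i<n. if i = j then 1 else 0)"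
      by (rule sum.cong) (use ij in auto)
    then show ?thesis using ij by (simp add: euclidean_norm_vec_def L2_set_def)
  qed
  finally show ?thesis using A ij by simp
qed

text \<open>Let \<open>\<rho> < \<gamma>\<close> and let \<open>F\<close> consist of the rows of all products \<open>S\<close> of length \<open>t\<close>, divided by \<open>\<gamma> ^ t\<close>.
  By the choice of \<open>\<gamma>\<close> the set \<open>F\<close> is bounded, and composing \<open>f\<close> in \<open>F\<close> with a matrix of \<open>\<M>\<close> gives \<open>\<gamma>\<close> times
  another element of \<open>F\<close>. Hence the norm defined by \<open>F\<close> is contracted at rate \<open>\<gamma>\<close>, and the nearby Euclidean
  norm at rate \<open>sqrt (n + \<delta>) * \<gamma>\<close>. Pivoted orthogonalisation writes it as a weighted norm in
  coordinates \<open>W\<close> with entries bounded independently of \<open>c\<close>, and so are those of \<open>Z = W\<inverse>\<close>.\<close>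

lemma ex_nearly_contracting_coordinates:
  fixes \<M> :: "'a::{real_normed_field,real_inner} mat set"
  assumes n: "n \<ge> 1" and M: "\<M> \<subseteq> carrier_mat n n" and ne: "\<M> \<noteq> {}"
    and bounded: "\<And>A x. A \<in> \<M> \<Longrightarrow> x \<in> carrier_vec n \<Longrightarrow>
      euclidean_norm_vec (A *\<^sub>v x) \<le> C * euclidean_norm_vec x"
    and c: "sqrt (real n) * joint_spectral_radius n \<M> < c"
  shows "\<exists>e W Z. (\<forall>i<n. 0 < e i) \<and> W \<in> carrier_mat n n \<and> Z \<in> carrier_mat n n
    \<and> W * Z = 1\<^sub>m n \<and> Z * W = 1\<^sub>m n
    \<and> (\<forall>i<n. \<forall>j<n. norm (W $$ (i, j)) \<le> 1) \<and> (\<forall>i<n. \<forall>j<n. norm (Z $$ (i, j)) \<le> fact n)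
    \<and> (\<forall>A\<in>\<M>. \<forall>x\<in>carrier_vec n. weighted_norm e ((W * A * Z) *\<^sub>v x) \<le> c * weighted_norm e x)"
proof -
  define \<rho> where "\<rho> = joint_spectral_radius n \<M>"
  \<comment> \<open>The midpoint leaves room on both sides; \<open>\<delta>\<close> is then chosen so that the
    final rate is exactly \<open>c\<close>.\<close>
  define \<gamma> where "\<gamma> = (\<rho> + c / sqrt (real n)) / 2"
  define \<delta> where "\<delta> = (c / \<gamma>)\<^sup>2 - real n"
  have rho: "\<rho> \<ge> 0" unfolding \<rho>_def by (rule joint_spectral_radius_nonneg[OF M ne bounded])
  have "\<rho> < c / sqrt (real n)" using c n by (simp add: \<rho>_def field_simps)
  then have g: "\<rho> < \<gamma> \<and> \<gamma> < c / sqrt (real n)"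
    unfolding \<gamma>_def using less_half_sum gt_half_sum by (metis one_add_one)
  then have g0: "\<gamma> > 0" using rho by linarith
  have "sqrt (real n) < c / \<gamma>" using g g0 n by (simp add: field_simps)
  then have "(sqrt (real n))\<^sup>2 < (c / \<gamma>)\<^sup>2" by (intro power_strict_mono) auto
  then have d: "\<delta> > 0" by (simp add: \<delta>_def)
  have c0: "c > 0" using c mult_nonneg_nonneg[OF real_sqrt_ge_zero[OF of_nat_0_le_iff[of n]] rho] unfolding \<rho>_def by linarith
  have sq: "sqrt (real n + \<delta>) * \<gamma> = c" using c0 g0 by (simp add: \<delta>_def real_sqrt_abs)
  obtain K where K: "\<And>t S. S \<in> products n \<M> t \<Longrightarrow> spectral_norm S \<le> K * \<gamma> ^ t"
    using products_growth[OF M ne bounded conjunct1[OF g[unfolded \<rho>_def]]] by blast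
  define F where "F = {of_real (1 / \<gamma> ^ t) \<cdot>\<^sub>v row S i | t S i. S \<in> products n \<M> t \<and> i < n}"
  have F_prod: "(of_real (1 / \<gamma> ^ t) \<cdot>\<^sub>v row S i) \<bullet> x = of_real (1 / \<gamma> ^ t) * (S *\<^sub>v x) $ i"
    if "S \<in> products n \<M> t" "i < n" "x \<in> carrier_vec n" for t S i and x :: "'a vec"
    using products_carrier[OF M that(1)] that(2,3) by simp
  have F_carrier: "F \<subseteq> carrier_vec n"
    using products_carrier[OF M] by (auto simp: F_def)
  have F_unit: "unit_vec n i \<in> F" if i: "i < n" for i
  proof -
    have "1\<^sub>m n \<in> products n \<M> 0" by (simp add: products_def)
    moreover have "unit_vec n i = of_real (1 / \<gamma> ^ 0) \<cdot>\<^sub>v row (1\<^sub>m n) i" using i by simp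
    ultimately show ?thesis unfolding F_def using i by blast
  qed
  have F_bounded: "norm (f $ j) \<le> K" if f: "f \<in> F" and j: "j < n" for f j
  proof -
    obtain t S i where S: "S \<in> products n \<M> t" "i < n" and f_eq: "f = of_real (1 / \<gamma> ^ t) \<cdot>\<^sub>v row S i"
      using f by (auto simp: F_def)
    have Sc: "S \<in> carrier_mat n n" by (rule products_carrier[OF M S(1)])
    have "norm (S $$ (i, j)) \<le> K * \<gamma> ^ t"
      using norm_entry_le_spectral_norm[OF Sc S(2) j] K[OF S(1)] by simp
    then show ?thesis
      using Sc S j g0 by (simp add: f_eq norm_mult norm_divide norm_power field_simps)
  qed
  obtain R where R: "R \<in> carrier_mat n n" "det R \<noteq> 0"
    and R_le: "\<And>x c. x \<in> carrier_vec n \<Longrightarrow> 0 \<le> c \<Longrightarrow> (\<And>f. f \<in> F \<Longrightarrow> norm (f \<bullet> x) \<le> c)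
      \<Longrightarrow> euclidean_norm_vec (R *\<^sub>v x) \<le> c"
    and R_ge: "\<And>f x. f \<in> F \<Longrightarrow> x \<in> carrier_vec n \<Longrightarrow>
      norm (f \<bullet> x) \<le> sqrt (real n + \<delta>) * euclidean_norm_vec (R *\<^sub>v x)"
    using nearly_optimal_form[OF n F_carrier F_unit F_bounded d] by blast
  have RA: "euclidean_norm_vec (R *\<^sub>v (A *\<^sub>v x)) \<le> c * euclidean_norm_vec (R *\<^sub>v x)"
    if A: "A \<in> \<M>" and x: "x \<in> carrier_vec n" for A x
  proof (rule R_le)
    have Ac: "A \<in> carrier_mat n n" using A M by blast
    show "A *\<^sub>v x \<in> carrier_vec n" using Ac x by simp
    show "0 \<le> c * euclidean_norm_vec (R *\<^sub>v x)" using c0 by simp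
    fix f assume "f \<in> F"
    then obtain t S i where S: "S \<in> products n \<M> t" "i < n" and f_eq: "f = of_real (1 / \<gamma> ^ t) \<cdot>\<^sub>v row S i"
      by (auto simp: F_def)
    have SA: "S * A \<in> products n \<M> (Suc t)" by (rule products_mult_right[OF M S(1) A])
    define f' where "f' = of_real (1 / \<gamma> ^ Suc t) \<cdot>\<^sub>v row (S * A) i"
    have "f' \<in> F" unfolding F_def f'_def using SA S(2) by blast
    have "f \<bullet> (A *\<^sub>v x) = of_real (1 / \<gamma> ^ t) * ((S * A) *\<^sub>v x) $ i"
      unfolding f_eq using F_prod[OF S] Ac x assoc_mult_mat_vec[OF products_carrier[OF M S(1)] Ac x] by simp
    also have "of_real (1 / \<gamma> ^ t) = (of_real \<gamma> * of_real (1 / \<gamma> ^ Suc t) :: 'a)"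
      unfolding of_real_mult[symmetric] using g0 by simp
    finally have "f \<bullet> (A *\<^sub>v x) = of_real \<gamma> * (f' \<bullet> x)"
      unfolding f'_def F_prod[OF SA S(2) x] by (simp only: mult.assoc)
    then have "norm (f \<bullet> (A *\<^sub>v x)) = \<gamma> * norm (f' \<bullet> x)" using g0 by (simp add: norm_mult)
    also have "\<dots> \<le> \<gamma> * (sqrt (real n + \<delta>) * euclidean_norm_vec (R *\<^sub>v x))"
      using R_ge[OF \<open>f' \<in> F\<close> x] g0 by simp
    also have "\<dots> = (sqrt (real n + \<delta>) * \<gamma>) * euclidean_norm_vec (R *\<^sub>v x)" by (simp only: mult_ac)
    finally show "norm (f \<bullet> (A *\<^sub>v x)) \<le> c * euclidean_norm_vec (R *\<^sub>v x)" unfolding sq .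
  qed
  have inj: "x i = 0" if x: "\<And>k. k \<in> {..<n} \<Longrightarrow> (\<Sum>i\<in>{..<n}. x i * R $$ (k, i)) = 0" and i: "i \<in> {..<n}" for x i
  proof -
    have "R *\<^sub>v vec n x = 0\<^sub>v n"
    proof (rule eq_vecI)
      fix k assume "k < dim_vec (0\<^sub>v n :: 'a vec)"
      then have k: "k < n" by simp
      have "(R *\<^sub>v vec n x) $ k = (\<Sum>i<n. R $$ (k, i) * vec n x $ i)"
        by (rule mult_mat_vec_index[OF R(1) _ k]) simp
      also have "\<dots> = (\<Sum>i<n. x i * R $$ (k, i))" by (rule sum.cong) (auto simp: mult.commute)
      finally show "(R *\<^sub>v vec n x) $ k = 0\<^sub>v n $ k" using x k by simp
    qed (use R in simp)
    then have "vec n x = 0\<^sub>v n"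
      using det_0_iff_vec_prod_zero[OF R(1)] R(2) vec_carrier[of n x] by blast
    then have "vec n x $ i = 0\<^sub>v n $ i" by simp
    then show ?thesis using i by simp
  qed
  then have "\<forall>x. (\<forall>k\<in>{..<n}. (\<Sum>i\<in>{..<n}. x i * R $$ (k, i)) = 0) \<longrightarrow> (\<forall>i\<in>{..<n}. x i = 0)" by blast
  from pivoted_gram_schmidt[OF finite_lessThan finite_lessThan this] obtain g D where D: "\<forall>s\<in>{..<n}. 0 < D s" and g1: "\<forall>s\<in>{..<n}. \<forall>i\<in>{..<n}. norm (g s i) \<le> 1"
    and gD: "\<forall>x. (\<Sum>k\<in>{..<n}. (norm (\<Sum>i\<in>{..<n}. x i * R $$ (k, i)))\<^sup>2)
           = (\<Sum>s\<in>{..<n}. (D s)\<^sup>2 * (norm (\<Sum>i\<in>{..<n}. g s i * x i))\<^sup>2)"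
    and gm: "\<forall>x m. (\<forall>s\<in>{..<n}. norm (\<Sum>i\<in>{..<n}. g s i * x i) \<le> m)
           \<longrightarrow> (\<forall>i\<in>{..<n}. norm (x i) \<le> fact (card {..<n}) * m)"
    by (elim exE conjE)
  define W where "W = mat n n (\<lambda>(s, i). g s i)"
  have W: "W \<in> carrier_mat n n" by (simp add: W_def)
  have Wx: "(W *\<^sub>v x) $ s = (\<Sum>i<n. g s i * x $ i)" if "x \<in> carrier_vec n" "s < n" for x s
    unfolding mult_mat_vec_index[OF W that] by (rule sum.cong) (use that in \<open>auto simp: W_def\<close>)
  have W_bound: "norm (x $ i) \<le> fact n * m"
    if "x \<in> carrier_vec n" "\<And>s. s < n \<Longrightarrow> norm ((W *\<^sub>v x) $ s) \<le> m" "i < n" for x m i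
    using gm[rule_format, of "\<lambda>i. x $ i" m i] that Wx by simp
  have WR: "weighted_norm D (W *\<^sub>v x) = euclidean_norm_vec (R *\<^sub>v x)" if x: "x \<in> carrier_vec n" for x
  proof -
    have "(weighted_norm D (W *\<^sub>v x))\<^sup>2 = (\<Sum>s<n. (D s)\<^sup>2 * (norm (\<Sum>i<n. g s i * x $ i))\<^sup>2)"
      using W Wx[OF x] by (simp add: weighted_norm_square)
    also have "\<dots> = (\<Sum>k<n. (norm (\<Sum>i<n. x $ i * R $$ (k, i)))\<^sup>2)" using gD by simp
    also have "\<dots> = (euclidean_norm_vec (R *\<^sub>v x))\<^sup>2"
      using R mult_mat_vec_index[OF R(1) x] by (simp add: euclidean_norm_vec_square mult.commute)
    finally show ?thesis by (rule power2_eq_imp_eq) auto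
  qed
  have "det W \<noteq> 0"
  proof
    assume "det W = 0"
    then obtain v where v: "v \<in> carrier_vec n" "v \<noteq> 0\<^sub>v n" "W *\<^sub>v v = 0\<^sub>v n"
      using det_0_iff_vec_prod_zero[OF W] by blast
    have "v $ i = 0" if "i < n" for i using W_bound[OF v(1), of 0 i] v(3) that by simp
    then show False using v by (auto intro!: eq_vecI)
  qed
  then obtain Z where Z: "Z \<in> carrier_mat n n" "W * Z = 1\<^sub>m n" "Z * W = 1\<^sub>m n"
    using ex_inverse_mat[OF W] by blast
  have WZ: "W *\<^sub>v (Z *\<^sub>v x) = x" if "x \<in> carrier_vec n" for x
    using assoc_mult_mat_vec[OF W Z(1) that] Z(2) that by simp
  have Z_bound: "norm (Z $$ (i, j)) \<le> fact n" if ij: "i < n" "j < n" for i j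
  proof -
    have "norm ((Z *\<^sub>v unit_vec n j) $ i) \<le> fact n * 1"
      by (rule W_bound) (use Z ij in \<open>auto simp: WZ\<close>)
    then show ?thesis using Z ij by simp
  qed
  have "weighted_norm D ((W * A * Z) *\<^sub>v x) \<le> c * weighted_norm D x"
    if A: "A \<in> \<M>" and x: "x \<in> carrier_vec n" for A x
  proof -
    have Ac: "A \<in> carrier_mat n n" using A M by blast
    have Zx: "Z *\<^sub>v x \<in> carrier_vec n" using Z x by simp
    have "(W * A * Z) *\<^sub>v x = W *\<^sub>v (A *\<^sub>v (Z *\<^sub>v x))"
      unfolding assoc_mult_mat_vec[OF mult_carrier_mat[OF W Ac] Z(1) x] assoc_mult_mat_vec[OF W Ac Zx] ..
    then have "weighted_norm D ((W * A * Z) *\<^sub>v x) = euclidean_norm_vec (R *\<^sub>v (A *\<^sub>v (Z *\<^sub>v x)))"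
      using WR Ac Zx by simp
    also have "\<dots> \<le> c * euclidean_norm_vec (R *\<^sub>v (Z *\<^sub>v x))" by (rule RA[OF A Zx])
    also have "euclidean_norm_vec (R *\<^sub>v (Z *\<^sub>v x)) = weighted_norm D x"
      using WR[OF Zx] WZ[OF x] by simp
    finally show ?thesis .
  qed
  moreover have "norm (W $$ (i, j)) \<le> 1" if "i < n" "j < n" for i j using g1 that by (simp add: W_def)
  ultimately show ?thesis using D W Z Z_bound by (intro exI[of _ D] exI[of _ W] exI[of _ Z]) auto
qed

section \<open>Passing to the limit\<close>

lemma finite_family_convergent_subsequence:
  fixes u :: "nat \<Rightarrow> 'i \<Rightarrow> 'b::heine_borel"
  assumes "finite I" "\<And>i. i \<in> I \<Longrightarrow> bounded (range (\<lambda>k. u k i))"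
  shows "\<exists>r l. strict_mono r \<and> (\<forall>i\<in>I. (\<lambda>k. u (r k) i) \<longlonglongrightarrow> l i)"
  using assms
proof (induction I rule: finite_induct)
  case empty
  then show ?case using strict_mono_id by blast
next
  case (insert a I)
  then obtain r l where r: "strict_mono r" and l: "\<And>i. i \<in> I \<Longrightarrow> (\<lambda>k. u (r k) i) \<longlonglongrightarrow> l i"
    by auto
  have "bounded (range (\<lambda>k. u (r k) a))"
    by (rule bounded_subset[of "range (\<lambda>k. u k a)"]) (use insert.prems in auto)
  then obtain la r' where r': "strict_mono r'" and la: "((\<lambda>k. u (r k) a) \<circ> r') \<longlonglongrightarrow> la"
    using bounded_imp_convergent_subsequence by blast
  have "strict_mono (r \<circ> r')" by (rule strict_mono_o[OF r r'])
  moreover have "(\<lambda>k. u ((r \<circ> r') k) i) \<longlonglongrightarrow> (l(a := la)) i" if "i \<in> insert a I" for i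
    using la LIMSEQ_subseq_LIMSEQ[OF l r'] that insert.hyps(2) by (auto simp: o_def)
  ultimately show ?case by blast
qed

text \<open>Ratios of positive sequences may tend to infinity, so compactness is applied to
  \<open>e i / (e i + e j)\<close>, which stays in the unit interval.\<close>

lemma ratio_convergent_subsequence:
  fixes e :: "nat \<Rightarrow> 'i \<Rightarrow> real"
  assumes I: "finite I" and pos: "\<And>k i. i \<in> I \<Longrightarrow> 0 < e k i"
  shows "\<exists>r. strict_mono r \<and> (\<forall>i\<in>I. \<forall>j\<in>I.
    (\<exists>L>0. (\<lambda>k. e (r k) i / e (r k) j) \<longlonglongrightarrow> L)
    \<or> (\<lambda>k. e (r k) i / e (r k) j) \<longlonglongrightarrow> 0 \<or> (\<lambda>k. e (r k) j / e (r k) i) \<longlonglongrightarrow> 0)"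
proof -
  define \<theta> where "\<theta> k p = e k (fst p) / (e k (fst p) + e k (snd p))" for k p
  have bd: "0 < \<theta> k p" "\<theta> k p < 1" if "p \<in> I \<times> I" for k p
    using pos[of "fst p" k] pos[of "snd p" k] that by (auto simp: \<theta>_def)
  have "bounded (range (\<lambda>k. \<theta> k p))" if "p \<in> I \<times> I" for p
    by (rule boundedI[of _ 1]) (use bd[OF that] in \<open>auto simp: less_imp_le abs_of_pos\<close>)
  then have "\<exists>r l. strict_mono r \<and> (\<forall>p\<in>I \<times> I. (\<lambda>k. \<theta> (r k) p) \<longlonglongrightarrow> l p)"
    using I by (intro finite_family_convergent_subsequence) simp_all
  then obtain r \<Theta> where r: "strict_mono r" and lim: "\<And>p. p \<in> I \<times> I \<Longrightarrow> (\<lambda>k. \<theta> (r k) p) \<longlonglongrightarrow> \<Theta> p"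
    by blast
  have "(\<exists>L>0. (\<lambda>k. e (r k) i / e (r k) j) \<longlonglongrightarrow> L)
    \<or> (\<lambda>k. e (r k) i / e (r k) j) \<longlonglongrightarrow> 0 \<or> (\<lambda>k. e (r k) j / e (r k) i) \<longlonglongrightarrow> 0"
    if ij: "i \<in> I" "j \<in> I" for i j
  proof -
    have p: "(i, j) \<in> I \<times> I" using ij by simp
    define L where "L = \<Theta> (i, j)"
    have L: "(\<lambda>k. \<theta> (r k) (i, j)) \<longlonglongrightarrow> L" unfolding L_def by (rule lim[OF p])
    have L0: "0 \<le> L" by (rule LIMSEQ_le_const[OF L]) (use bd[OF p] in \<open>auto intro: less_imp_le\<close>)
    have L1: "L \<le> 1" by (rule LIMSEQ_le_const2[OF L]) (use bd[OF p] in \<open>auto intro: less_imp_le\<close>)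
    have compl: "1 - \<theta> k (i, j) = e k j / (e k i + e k j)" for k
      using pos[OF ij(1), of k] pos[OF ij(2), of k] by (simp add: \<theta>_def field_simps)
    have q1: "e k i / e k j = \<theta> k (i, j) / (1 - \<theta> k (i, j))"
      and q2: "e k j / e k i = (1 - \<theta> k (i, j)) / \<theta> k (i, j)" for k
      unfolding compl using pos[OF ij(1), of k] pos[OF ij(2), of k] by (simp_all add: \<theta>_def)
    show ?thesis
    proof (cases "L = 1")
      case True
      have "(\<lambda>k. e (r k) j / e (r k) i) \<longlonglongrightarrow> (1 - L) / L"
        unfolding q2 by (intro tendsto_intros L) (use True in simp)
      then show ?thesis using True by simp
    next
      case False
      then have "(\<lambda>k. e (r k) i / e (r k) j) \<longlonglongrightarrow> L / (1 - L)"
        unfolding q1 by (intro tendsto_intros L) simp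
      then show ?thesis using L0 L1 False by (cases "L = 0") auto
    qed
  qed
  then show ?thesis using r by blast
qed

lemma weighted_norm_triangle:
  fixes x y :: "'a::real_normed_field vec"
  assumes "x \<in> carrier_vec n" "y \<in> carrier_vec n" "\<And>i. i < n \<Longrightarrow> 0 \<le> e i"
  shows "weighted_norm e (x + y) \<le> weighted_norm e x + weighted_norm e y"
proof -
  have "weighted_norm e (x + y) \<le> L2_set (\<lambda>i. e i * norm (x $ i) + e i * norm (y $ i)) {..<n}"
    unfolding weighted_norm_def using assms
    by (auto intro!: L2_set_mono mult_left_mono norm_triangle_ineq simp flip: distrib_left)
  also have "\<dots> \<le> weighted_norm e x + weighted_norm e y"
    unfolding weighted_norm_def using assms L2_set_triangle_ineq by fastforce
  finally show ?thesis .
qed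

lemma weighted_norm_entry_le:
  fixes B :: "'a::real_normed_field mat"
  assumes B: "B \<in> carrier_mat n n" and e: "\<And>i. i < n \<Longrightarrow> 0 \<le> e i"
    and b: "\<And>x. x \<in> carrier_vec n \<Longrightarrow> weighted_norm e (B *\<^sub>v x) \<le> c * weighted_norm e x"
    and ij: "i < n" "j < n"
  shows "e i * norm (B $$ (i, j)) \<le> c * e j"
proof -
  have "e i * norm ((B *\<^sub>v unit_vec n j) $ i) \<le> weighted_norm e (B *\<^sub>v unit_vec n j)"
    unfolding weighted_norm_def
    by (rule member_le_L2_set[where f = "\<lambda>i. e i * norm ((B *\<^sub>v unit_vec n j) $ i)"]) (use B ij in auto)
  also have "\<dots> \<le> c * weighted_norm e (unit_vec n j :: 'a vec)" by (rule b) simp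
  also have "weighted_norm e (unit_vec n j :: 'a vec) = e j"
  proof -
    have "(weighted_norm e (unit_vec n j :: 'a vec))\<^sup>2 = (\<Sum>i<n. if i = j then (e j)\<^sup>2 else 0)"
      unfolding weighted_norm_square by (rule sum.cong) (use ij in auto)
    then have "(weighted_norm e (unit_vec n j :: 'a vec))\<^sup>2 = (e j)\<^sup>2" using ij by simp
    then show ?thesis by (rule power2_eq_imp_eq) (use e ij in auto)
  qed
  finally show ?thesis using B ij by simp
qed

text \<open>Deleting the entries between different classes does not increase the operator norm: the classes
  give orthogonal decompositions of both the argument and the image.\<close>

lemma weighted_norm_pinching_le:
  fixes B F :: "'a::real_normed_field mat" and cl :: "nat \<Rightarrow> 'c"
  assumes B: "B \<in> carrier_mat n n" and F: "F \<in> carrier_mat n n"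
    and FB: "\<And>i j. i < n \<Longrightarrow> j < n \<Longrightarrow> F $$ (i, j) = (if cl i = cl j then B $$ (i, j) else 0)"
    and c: "0 \<le> c"
    and b: "\<And>x. x \<in> carrier_vec n \<Longrightarrow> weighted_norm e (B *\<^sub>v x) \<le> c * weighted_norm e x"
    and x: "x \<in> carrier_vec n"
  shows "weighted_norm e (F *\<^sub>v x) \<le> c * weighted_norm e x"
proof -
  define P where "P k = vec n (\<lambda>j. if cl j = k then x $ j else 0)" for k
  have P: "P k \<in> carrier_vec n" for k by (simp add: P_def)
  have FP: "(F *\<^sub>v x) $ i = (B *\<^sub>v P (cl i)) $ i" if i: "i < n" for i
    unfolding mult_mat_vec_index[OF F x i] mult_mat_vec_index[OF B P i]
    by (rule sum.cong) (use i in \<open>auto simp: FB P_def\<close>)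
  have group: "(\<Sum>k\<in>cl ` {..<n}. \<Sum>i\<in>{i\<in>{..<n}. cl i = k}. h i) = (\<Sum>i<n. h i)" for h :: "nat \<Rightarrow> real"
    by (rule sum.group) auto
  have "(weighted_norm e (F *\<^sub>v x))\<^sup>2 = (\<Sum>i<n. (e i)\<^sup>2 * (norm ((B *\<^sub>v P (cl i)) $ i))\<^sup>2)"
    unfolding weighted_norm_square by (rule sum.cong) (use F FP in auto)
  also have "\<dots> = (\<Sum>k\<in>cl ` {..<n}. \<Sum>i\<in>{i\<in>{..<n}. cl i = k}. (e i)\<^sup>2 * (norm ((B *\<^sub>v P (cl i)) $ i))\<^sup>2)"
    by (rule group[symmetric])
  also have "\<dots> = (\<Sum>k\<in>cl ` {..<n}. \<Sum>i\<in>{i\<in>{..<n}. cl i = k}. (e i)\<^sup>2 * (norm ((B *\<^sub>v P k) $ i))\<^sup>2)"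
    by (intro sum.cong refl) auto
  also have "\<dots> \<le> (\<Sum>k\<in>cl ` {..<n}. (weighted_norm e (B *\<^sub>v P k))\<^sup>2)"
    unfolding weighted_norm_square using B by (auto intro!: sum_mono sum_mono2)
  also have "\<dots> \<le> (\<Sum>k\<in>cl ` {..<n}. (c * weighted_norm e (P k))\<^sup>2)"
    by (intro sum_mono power_mono b P) simp
  also have "\<dots> = c\<^sup>2 * (\<Sum>k\<in>cl ` {..<n}. \<Sum>i\<in>{i\<in>{..<n}. cl i = k}. (e i)\<^sup>2 * (norm (x $ i))\<^sup>2)"
  proof -
    have "(weighted_norm e (P k))\<^sup>2 = (\<Sum>i\<in>{i\<in>{..<n}. cl i = k}. (e i)\<^sup>2 * (norm (x $ i))\<^sup>2)" for k
    proof -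
      have "(weighted_norm e (P k))\<^sup>2 = (\<Sum>i<n. if cl i = k then (e i)\<^sup>2 * (norm (x $ i))\<^sup>2 else 0)"
        unfolding weighted_norm_square by (rule sum.cong) (auto simp: P_def)
      then show ?thesis by (simp add: sum.If_cases Int_def conj_commute)
    qed
    then show ?thesis by (simp add: power_mult_distrib sum_distrib_left)
  qed
  also have "\<dots> = (c * weighted_norm e x)\<^sup>2"
    unfolding group using x by (simp add: weighted_norm_square power_mult_distrib)
  finally show ?thesis by (rule power2_le_imp_le) (use c in simp)
qed

lemma mult_mat_index:
  assumes "A \<in> carrier_mat n n" "B \<in> carrier_mat n n" "i < n" "j < n"
  shows "(A * B) $$ (i, j) = (\<Sum>l<n. A $$ (i, l) * B $$ (l, j))"
  using assms by (auto simp: scalar_prod_def lessThan_atLeast0 intro!: sum.cong)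

lemma mult_mult_mat_index:
  assumes "W \<in> carrier_mat n n" "A \<in> carrier_mat n n" "Z \<in> carrier_mat n n" "i < n" "j < n"
  shows "(W * A * Z) $$ (i, j) = (\<Sum>m<n. \<Sum>l<n. W $$ (i, l) * A $$ (l, m) * Z $$ (m, j))"
proof -
  have WA: "W * A \<in> carrier_mat n n" using assms by simp
  have "(W * A * Z) $$ (i, j) = (\<Sum>m<n. (W * A) $$ (i, m) * Z $$ (m, j))"
    by (rule mult_mat_index[OF WA assms(3-5)])
  also have "\<dots> = (\<Sum>m<n. (\<Sum>l<n. W $$ (i, l) * A $$ (l, m)) * Z $$ (m, j))"
    by (rule sum.cong[OF refl]) (use mult_mat_index[OF assms(1,2,4)] in auto)
  finally show ?thesis by (simp add: sum_distrib_right)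
qed

text \<open>The error bound is uniform in the middle factor, so that one index works for all matrices of a
  bounded set.\<close>

lemma triple_product_tendsto:
  fixes W :: "'a::real_normed_field mat"
  assumes "W \<in> carrier_mat n n" "Z \<in> carrier_mat n n"
    and "\<And>k. Wk k \<in> carrier_mat n n" "\<And>k. Zk k \<in> carrier_mat n n"
    and Wlim: "\<And>i j. i < n \<Longrightarrow> j < n \<Longrightarrow> (\<lambda>k. Wk k $$ (i, j)) \<longlonglongrightarrow> W $$ (i, j)"
    and Zlim: "\<And>i j. i < n \<Longrightarrow> j < n \<Longrightarrow> (\<lambda>k. Zk k $$ (i, j)) \<longlonglongrightarrow> Z $$ (i, j)"
    and C: "0 \<le> C" and ij: "i < n" "j < n"
  obtains err :: "nat \<Rightarrow> real" where "err \<longlonglongrightarrow> 0"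
    "\<And>k A. A \<in> carrier_mat n n \<Longrightarrow> (\<And>l m. l < n \<Longrightarrow> m < n \<Longrightarrow> norm (A $$ (l, m)) \<le> C) \<Longrightarrow>
      norm ((W * A * Z) $$ (i, j) - (Wk k * A * Zk k) $$ (i, j)) \<le> err k"
proof -
  define err where "err k = (\<Sum>m<n. \<Sum>l<n. C * norm (W $$ (i, l) * Z $$ (m, j) - Wk k $$ (i, l) * Zk k $$ (m, j)))" for k
  have "err \<longlonglongrightarrow> (\<Sum>m<n. \<Sum>l<n. C * norm (W $$ (i, l) * Z $$ (m, j) - W $$ (i, l) * Z $$ (m, j)))"
    unfolding err_def by (intro tendsto_intros Wlim Zlim) (use ij in auto)
  then have "err \<longlonglongrightarrow> 0" by simp
  moreover have "norm ((W * A * Z) $$ (i, j) - (Wk k * A * Zk k) $$ (i, j)) \<le> err k"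
    if A: "A \<in> carrier_mat n n" and b: "\<And>l m. l < n \<Longrightarrow> m < n \<Longrightarrow> norm (A $$ (l, m)) \<le> C" for k A
  proof -
    have "(W * A * Z) $$ (i, j) - (Wk k * A * Zk k) $$ (i, j)
        = (\<Sum>m<n. \<Sum>l<n. A $$ (l, m) * (W $$ (i, l) * Z $$ (m, j) - Wk k $$ (i, l) * Zk k $$ (m, j)))"
      unfolding mult_mult_mat_index[OF assms(1) A assms(2) ij] mult_mult_mat_index[OF assms(3) A assms(4) ij]
      by (simp add: sum_subtractf[symmetric] algebra_simps)
    also have "norm \<dots> \<le> err k"
      unfolding err_def
    proof (rule order_trans[OF norm_sum sum_mono])
      fix m assume m: "m \<in> {..<n}"
      show "norm (\<Sum>l<n. A $$ (l, m) * (W $$ (i, l) * Z $$ (m, j) - Wk k $$ (i, l) * Zk k $$ (m, j)))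
        \<le> (\<Sum>l<n. C * norm (W $$ (i, l) * Z $$ (m, j) - Wk k $$ (i, l) * Zk k $$ (m, j)))"
        by (rule order_trans[OF norm_sum sum_mono], unfold norm_mult, rule mult_right_mono)
           (use b m in auto)
    qed
    finally show ?thesis .
  qed
  ultimately show ?thesis using that by blast
qed

text \<open>The coordinates \<open>W\<^sub>k\<close> for rates decreasing to \<open>c\<close> lie in a compact set together with their inverses, so
  along a subsequence they converge to invertible \<open>W\<close>; only the weights may degenerate. Call \<open>i\<close> and
  \<open>j\<close> comparable if the ratio of their weights has a positive finite limit. In the \<open>k\<close>-th weights, for
  large \<open>k\<close>, the limit matrix \<open>W A Z\<close> is close to the pinching of \<open>W\<^sub>k A Z\<^sub>k\<close> to the classes of comparable
  indices: within a class the bounded ratio preserves convergence; where the ratio tends to zero the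
  entry is scaled away; where it tends to infinity the contraction of \<open>W\<^sub>k A Z\<^sub>k\<close> forces the limit
  entry to vanish. Since pinching keeps the rate, the \<^emph>\<open>fixed\<close> coordinates \<open>W\<close> reach every rate above \<open>c\<close>,
  at the price of weights that depend on the rate.\<close>

lemma ex_common_coordinates:
  fixes \<M> :: "'a::{real_normed_field,euclidean_space} mat set"
  assumes n: "n \<ge> 1" and M: "\<M> \<subseteq> carrier_mat n n" and ne: "\<M> \<noteq> {}"
    and C: "0 \<le> C" and bounded: "\<And>A i j. A \<in> \<M> \<Longrightarrow> i < n \<Longrightarrow> j < n \<Longrightarrow> norm (A $$ (i, j)) \<le> C"
    and c: "sqrt (real n) * joint_spectral_radius n \<M> \<le> c"
  obtains W Z where "W \<in> carrier_mat n n" "Z \<in> carrier_mat n n" "W * Z = 1\<^sub>m n" "Z * W = 1\<^sub>m n"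
    "\<And>\<eta>. 0 < \<eta> \<Longrightarrow> \<exists>e. (\<forall>i<n. 0 < e i) \<and> (\<forall>A\<in>\<M>. \<forall>x\<in>carrier_vec n.
      weighted_norm e ((W * A * Z) *\<^sub>v x) \<le> (c + \<eta>) * weighted_norm e x)"
proof -
  have opbound: "euclidean_norm_vec (A *\<^sub>v x) \<le> (real n * real n * C) * euclidean_norm_vec x"
    if "A \<in> \<M>" "x \<in> carrier_vec n" for A x
    by (rule euclidean_norm_mult_le_entries) (use that M bounded C in auto)
  have c0: "0 \<le> c"
    using c mult_nonneg_nonneg[OF real_sqrt_ge_zero[OF of_nat_0_le_iff[of n]]
        joint_spectral_radius_nonneg[OF M ne opbound]] by linarith
  define ck where "ck k = c + 1 / real (Suc k)" for k
  define adapted where "adapted k e W Z \<longleftrightarrow> (\<forall>i<n. 0 < e i) \<and> W \<in> carrier_mat n n \<and> Z \<in> carrier_mat n n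
    \<and> W * Z = 1\<^sub>m n \<and> Z * W = 1\<^sub>m n
    \<and> (\<forall>i<n. \<forall>j<n. norm (W $$ (i, j)) \<le> 1) \<and> (\<forall>i<n. \<forall>j<n. norm (Z $$ (i, j)) \<le> fact n)
    \<and> (\<forall>A\<in>\<M>. \<forall>x\<in>carrier_vec n. weighted_norm e ((W * A * Z) *\<^sub>v x) \<le> ck k * weighted_norm e x)"
    for k :: nat and e W Z
  have "\<exists>e W Z. adapted k e W Z" for k
    unfolding adapted_def
  proof (rule ex_nearly_contracting_coordinates[OF n M ne opbound])
    show "sqrt (real n) * joint_spectral_radius n \<M> < ck k"
      unfolding ck_def by (rule le_less_trans[OF c]) simp
  qed
  then obtain e0 W0 Z0 where adapted: "\<And>k. adapted k (e0 k) (W0 k) (Z0 k)" by metis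
  have e0: "0 < e0 k i" if "i < n" for k i
    using adapted[of k] that unfolding adapted_def by blast
  have W0: "W0 k \<in> carrier_mat n n" and Z0: "Z0 k \<in> carrier_mat n n"
    and inv0: "W0 k * Z0 k = 1\<^sub>m n" "Z0 k * W0 k = 1\<^sub>m n" for k
    using adapted[of k] unfolding adapted_def by blast+
  have W0b: "norm (W0 k $$ (i, j)) \<le> 1" and Z0b: "norm (Z0 k $$ (i, j)) \<le> fact n"
    if "i < n" "j < n" for k i j
    using adapted[of k] that unfolding adapted_def by blast+
  have contr0: "weighted_norm (e0 k) ((W0 k * A * Z0 k) *\<^sub>v x) \<le> ck k * weighted_norm (e0 k) x"
    if "A \<in> \<M>" "x \<in> carrier_vec n" for k A x
    using adapted[of k] that unfolding adapted_def by blast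
  define I where "I = {..<n} \<times> {..<n}"
  have "\<exists>r l. strict_mono r \<and> (\<forall>p\<in>I. (\<lambda>k. W0 (r k) $$ p) \<longlonglongrightarrow> l p)"
    by (rule finite_family_convergent_subsequence) (use W0b in \<open>auto simp: I_def intro!: boundedI\<close>)
  then obtain r1 LW where r1: "strict_mono r1"
    and LW: "\<And>p. p \<in> I \<Longrightarrow> (\<lambda>k. W0 (r1 k) $$ p) \<longlonglongrightarrow> LW p"
    by blast
  have "\<exists>r l. strict_mono r \<and> (\<forall>p\<in>I. (\<lambda>k. Z0 (r1 (r k)) $$ p) \<longlonglongrightarrow> l p)"
    by (rule finite_family_convergent_subsequence) (use Z0b in \<open>auto simp: I_def intro!: boundedI\<close>)
  then obtain r2 LZ where r2: "strict_mono r2"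
    and LZ: "\<And>p. p \<in> I \<Longrightarrow> (\<lambda>k. Z0 (r1 (r2 k)) $$ p) \<longlonglongrightarrow> LZ p"
    by blast
  obtain r3 where r3: "strict_mono r3" and
    ratio: "\<And>i j. i < n \<Longrightarrow> j < n \<Longrightarrow>
      (\<exists>L>0. (\<lambda>k. e0 (r1 (r2 (r3 k))) i / e0 (r1 (r2 (r3 k))) j) \<longlonglongrightarrow> L)
      \<or> (\<lambda>k. e0 (r1 (r2 (r3 k))) i / e0 (r1 (r2 (r3 k))) j) \<longlonglongrightarrow> 0
      \<or> (\<lambda>k. e0 (r1 (r2 (r3 k))) j / e0 (r1 (r2 (r3 k))) i) \<longlonglongrightarrow> 0"
    using ratio_convergent_subsequence[of "{..<n}" "\<lambda>k. e0 (r1 (r2 k))"] e0 by auto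
  define r where "r k = r1 (r2 (r3 k))" for k
  define e where "e k = e0 (r k)" for k
  define Wk where "Wk k = W0 (r k)" for k
  define Zk where "Zk k = Z0 (r k)" for k
  define W where "W = mat n n LW"
  define Z where "Z = mat n n LZ"
  have W: "W \<in> carrier_mat n n" and Z: "Z \<in> carrier_mat n n" by (auto simp: W_def Z_def)
  have Wk: "Wk k \<in> carrier_mat n n" and Zk: "Zk k \<in> carrier_mat n n" for k
    using W0 Z0 by (auto simp: Wk_def Zk_def)
  have r: "strict_mono r"
    using strict_mono_o[OF r1 strict_mono_o[OF r2 r3]] by (simp add: r_def[abs_def] o_def)
  have Wlim: "(\<lambda>k. Wk k $$ (i, j)) \<longlonglongrightarrow> W $$ (i, j)" if "i < n" "j < n" for i j
    using LIMSEQ_subseq_LIMSEQ[OF LW strict_mono_o[OF r2 r3], of "(i, j)"] that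
    by (simp add: I_def W_def Wk_def r_def o_def)
  have Zlim: "(\<lambda>k. Zk k $$ (i, j)) \<longlonglongrightarrow> Z $$ (i, j)" if "i < n" "j < n" for i j
    using LIMSEQ_subseq_LIMSEQ[OF LZ r3, of "(i, j)"] that
    by (simp add: I_def Z_def Zk_def r_def o_def)
  have inverse_lim: "X * Y = 1\<^sub>m n"
    if "X \<in> carrier_mat n n" "Y \<in> carrier_mat n n"
      "\<And>k. Xk k \<in> carrier_mat n n" "\<And>k. Yk k \<in> carrier_mat n n" "\<And>k. Xk k * Yk k = 1\<^sub>m n"
      "\<And>i j. i < n \<Longrightarrow> j < n \<Longrightarrow> (\<lambda>k. Xk k $$ (i, j)) \<longlonglongrightarrow> X $$ (i, j)"
      "\<And>i j. i < n \<Longrightarrow> j < n \<Longrightarrow> (\<lambda>k. Yk k $$ (i, j)) \<longlonglongrightarrow> Y $$ (i, j)"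
    for X Y :: "'a mat" and Xk Yk
  proof (rule eq_matI)
    fix i j assume "i < dim_row (1\<^sub>m n :: 'a mat)" "j < dim_col (1\<^sub>m n :: 'a mat)"
    then have ij: "i < n" "j < n" by auto
    have "(\<lambda>k. \<Sum>l<n. Xk k $$ (i, l) * Yk k $$ (l, j)) \<longlonglongrightarrow> (\<Sum>l<n. X $$ (i, l) * Y $$ (l, j))"
      by (intro tendsto_intros that(6,7)) (use ij in auto)
    then have "(\<lambda>k. (1\<^sub>m n :: 'a mat) $$ (i, j)) \<longlonglongrightarrow> (X * Y) $$ (i, j)"
      unfolding mult_mat_index[OF that(1,2) ij] mult_mat_index[OF that(3,4) ij, symmetric] that(5) .
    then show "(X * Y) $$ (i, j) = 1\<^sub>m n $$ (i, j)" using LIMSEQ_const_iff by metis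
  qed (use that in auto)
  have WZ: "W * Z = 1\<^sub>m n" by (rule inverse_lim[OF W Z Wk Zk _ Wlim Zlim]) (simp add: Wk_def Zk_def inv0)
  have ZW: "Z * W = 1\<^sub>m n" by (rule inverse_lim[OF Z W Zk Wk _ Zlim Wlim]) (simp add: Wk_def Zk_def inv0)
  have e: "0 < e k i" if "i < n" for k i using e0 that by (simp add: e_def)
  have contr: "weighted_norm (e k) ((Wk k * A * Zk k) *\<^sub>v x) \<le> ck (r k) * weighted_norm (e k) x"
    if "A \<in> \<M>" "x \<in> carrier_vec n" for k A x
    using contr0[OF that] by (simp add: e_def Wk_def Zk_def)
  have ck_lim: "(\<lambda>k. ck (r k)) \<longlonglongrightarrow> c"
  proof -
    have "ck \<longlonglongrightarrow> c + 0" unfolding ck_def by (intro tendsto_intros LIMSEQ_Suc[OF lim_1_over_n])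
    then show ?thesis using LIMSEQ_subseq_LIMSEQ[OF _ r] by (simp add: o_def)
  qed
  have ck0: "0 \<le> ck k" for k using c0 by (simp add: ck_def)
  define comparable where "comparable i j \<longleftrightarrow> (\<exists>L>0. (\<lambda>k. e k i / e k j) \<longlonglongrightarrow> L)" for i j
  have comparable_refl: "comparable i i" if "i < n" for i
  proof -
    have "e k i / e k i = 1" for k using e[OF that, of k] by simp
    then show ?thesis unfolding comparable_def by (intro exI[of _ 1]) simp
  qed
  have comparable_sym: "comparable j i" if ij: "comparable i j" for i j
  proof -
    obtain L where L: "L > 0" "(\<lambda>k. e k i / e k j) \<longlonglongrightarrow> L" using ij unfolding comparable_def by blast
    have "(\<lambda>k. inverse (e k i / e k j)) \<longlonglongrightarrow> inverse L" using L by (intro tendsto_inverse) auto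
    then show ?thesis unfolding comparable_def using L(1)
      by (intro exI[of _ "inverse L"]) simp
  qed
  have comparable_trans: "comparable i l" if ij: "comparable i j" and jl: "comparable j l" and j: "j < n" for i j l
  proof -
    obtain L where L: "L > 0" "(\<lambda>k. e k i / e k j) \<longlonglongrightarrow> L" using ij unfolding comparable_def by blast
    obtain L' where L': "L' > 0" "(\<lambda>k. e k j / e k l) \<longlonglongrightarrow> L'" using jl unfolding comparable_def by blast
    have "(\<lambda>k. (e k i / e k j) * (e k j / e k l)) \<longlonglongrightarrow> L * L'" by (intro tendsto_mult L L')
    moreover have "(e k i / e k j) * (e k j / e k l) = e k i / e k l" for k
      using e[OF j, of k] by simp
    ultimately have "(\<lambda>k. e k i / e k l) \<longlonglongrightarrow> L * L'" by (simp only:)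
    then show ?thesis unfolding comparable_def using L(1) L'(1)
      by (intro exI[of _ "L * L'"]) simp
  qed
  define cl where "cl i = {j. j < n \<and> comparable i j}" for i
  have cl_eq: "cl i = cl j \<longleftrightarrow> comparable i j" if ij: "i < n" "j < n" for i j
  proof
    assume "cl i = cl j"
    then show "comparable i j" using comparable_refl[OF ij(2)] ij by (auto simp: cl_def)
  next
    assume "comparable i j"
    then show "cl i = cl j" using comparable_sym comparable_trans ij unfolding cl_def by blast
  qed
  have close: "\<forall>\<^sub>F k in sequentially. \<forall>A\<in>\<M>. e k i * norm ((W * A * Z) $$ (i, j)
      - (if cl i = cl j then (Wk k * A * Zk k) $$ (i, j) else 0)) \<le> \<epsilon> * e k j"
    if ij: "i < n" "j < n" and eps: "\<epsilon> > 0" for i j \<epsilon>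
  proof -
    obtain err where err: "err \<longlonglongrightarrow> 0"
      and err_le: "\<And>k A. A \<in> carrier_mat n n \<Longrightarrow> (\<And>l m. l < n \<Longrightarrow> m < n \<Longrightarrow> norm (A $$ (l, m)) \<le> C) \<Longrightarrow>
      norm ((W * A * Z) $$ (i, j) - (Wk k * A * Zk k) $$ (i, j)) \<le> err k"
      using triple_product_tendsto[OF W Z Wk Zk Wlim Zlim C ij] by blast
    have err': "norm ((W * A * Z) $$ (i, j) - (Wk k * A * Zk k) $$ (i, j)) \<le> err k" if "A \<in> \<M>" for A k
      by (rule err_le) (use that M bounded in auto)
    have scale: "e k i * y \<le> \<epsilon> * e k j" if "e k i / e k j * b < \<epsilon>" "y \<le> b" for k y b
    proof -
      have "e k i * y \<le> e k i * b" using that(2) e[OF ij(1), of k] by simp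
      also have "\<dots> = (e k i / e k j * b) * e k j" using e[OF ij(2), of k] by simp
      also have "\<dots> \<le> \<epsilon> * e k j" using that(1) e[OF ij(2), of k] by (intro mult_right_mono) auto
      finally show ?thesis .
    qed
    consider (comp) "comparable i j"
      | (small) "\<not> comparable i j" "(\<lambda>k. e k i / e k j) \<longlonglongrightarrow> 0"
      | (large) "\<not> comparable i j" "(\<lambda>k. e k j / e k i) \<longlonglongrightarrow> 0"
      using ratio[OF ij] unfolding comparable_def e_def r_def by blast
    then show ?thesis
    proof cases
      case comp
      then obtain L where "(\<lambda>k. e k i / e k j) \<longlonglongrightarrow> L" unfolding comparable_def by blast
      then have "(\<lambda>k. e k i / e k j * err k) \<longlonglongrightarrow> L * 0" by (intro tendsto_mult err)
      then have "\<forall>\<^sub>F k in sequentially. e k i / e k j * err k < \<epsilon>"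
        using eps by (intro order_tendstoD(2)) auto
      then show ?thesis
        by (rule eventually_mono) (use scale err' comp cl_eq[OF ij] in auto)
    next
      case small
      define B where "B = (\<Sum>m<n. \<Sum>l<n. norm (W $$ (i, l)) * C * norm (Z $$ (m, j)))"
      have B: "norm ((W * A * Z) $$ (i, j)) \<le> B" if A: "A \<in> \<M>" for A
      proof -
        have Ac: "A \<in> carrier_mat n n" using A M by blast
        have "norm (\<Sum>l<n. W $$ (i, l) * A $$ (l, m) * Z $$ (m, j))
            \<le> (\<Sum>l<n. norm (W $$ (i, l)) * C * norm (Z $$ (m, j)))" if "m < n" for m
          by (rule order_trans[OF norm_sum sum_mono], unfold norm_mult, intro mult_right_mono mult_left_mono)
             (use bounded[OF A] that in auto)
        then show ?thesis unfolding mult_mult_mat_index[OF W Ac Z ij] B_def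
          by (rule order_trans[OF norm_sum sum_mono]) auto
      qed
      have "(\<lambda>k. e k i / e k j * B) \<longlonglongrightarrow> 0 * B" by (intro tendsto_intros small)
      then have "\<forall>\<^sub>F k in sequentially. e k i / e k j * B < \<epsilon>"
        using eps by (intro order_tendstoD(2)) auto
      then show ?thesis
        by (rule eventually_mono) (use scale B small(1) cl_eq[OF ij] in auto)
    next
      case large
      have zero: "(W * A * Z) $$ (i, j) = 0" if A: "A \<in> \<M>" for A
      proof -
        have Ac: "A \<in> carrier_mat n n" using A M by blast
        have bound: "norm ((Wk k * A * Zk k) $$ (i, j)) \<le> ck (r k) * (e k j / e k i)" for k
        proof -
          have "e k i * norm ((Wk k * A * Zk k) $$ (i, j)) \<le> ck (r k) * e k j"
            by (rule weighted_norm_entry_le[OF mult_carrier_mat[OF mult_carrier_mat[OF Wk Ac] Zk] _ contr[OF A] ij])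
               (use e in \<open>auto intro: less_imp_le\<close>)
          then show ?thesis using e[OF ij(1), of k] by (simp add: field_simps)
        qed
        have "(\<lambda>k. ck (r k) * (e k j / e k i) + err k) \<longlonglongrightarrow> c * 0 + 0"
          by (intro tendsto_intros ck_lim large err)
        moreover have "norm ((W * A * Z) $$ (i, j)) \<le> ck (r k) * (e k j / e k i) + err k" for k
          using norm_triangle_sub[of "(W * A * Z) $$ (i, j)" "(Wk k * A * Zk k) $$ (i, j)"]
            bound[of k] err'[OF A, of k] by linarith
        ultimately have "norm ((W * A * Z) $$ (i, j)) \<le> c * 0 + 0"
          by (intro LIMSEQ_le_const) auto
        then show ?thesis by simp
      qed
      show ?thesis
      proof (intro always_eventually allI ballI)
        fix k A assume A: "A \<in> \<M>"
        have "cl i \<noteq> cl j" using large(1) cl_eq[OF ij] by simp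
        then show "e k i * norm ((W * A * Z) $$ (i, j)
            - (if cl i = cl j then (Wk k * A * Zk k) $$ (i, j) else 0)) \<le> \<epsilon> * e k j"
          using eps e[OF ij(2), of k] by (simp add: zero[OF A] less_imp_le)
      qed
    qed
  qed
  have main: "\<exists>e. (\<forall>i<n. 0 < e i) \<and> (\<forall>A\<in>\<M>. \<forall>x\<in>carrier_vec n.
      weighted_norm e ((W * A * Z) *\<^sub>v x) \<le> (c + \<eta>) * weighted_norm e x)" if eta: "0 < \<eta>" for \<eta>
  proof -
    \<comment> \<open>Half of \<open>\<eta>\<close> pays for the error matrix, by the crude bound on its norm;
      the other half for the rate of the approximating coordinates.\<close>
    define \<epsilon> where "\<epsilon> = \<eta> / (2 * (real n * real n))"
    have eps: "\<epsilon> > 0" using eta n by (simp add: \<epsilon>_def)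
    have n_eps: "real n * real n * \<epsilon> = \<eta> / 2" using n by (simp add: \<epsilon>_def)
    have "\<forall>\<^sub>F k in sequentially. \<forall>i\<in>{..<n}. \<forall>j\<in>{..<n}. \<forall>A\<in>\<M>. e k i * norm ((W * A * Z) $$ (i, j)
      - (if cl i = cl j then (Wk k * A * Zk k) $$ (i, j) else 0)) \<le> \<epsilon> * e k j"
      by (intro eventually_ball_finite ballI close eps) auto
    moreover have "\<forall>\<^sub>F k in sequentially. ck (r k) < c + \<eta> / 2"
      by (rule order_tendstoD(2)[OF ck_lim]) (use eta in simp)
    ultimately have "\<forall>\<^sub>F k in sequentially. (\<forall>i\<in>{..<n}. \<forall>j\<in>{..<n}. \<forall>A\<in>\<M>. e k i * norm ((W * A * Z) $$ (i, j)
      - (if cl i = cl j then (Wk k * A * Zk k) $$ (i, j) else 0)) \<le> \<epsilon> * e k j) \<and> ck (r k) < c + \<eta> / 2"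
      by (rule eventually_conj)
    then obtain k where k: "\<And>i j A. i < n \<Longrightarrow> j < n \<Longrightarrow> A \<in> \<M> \<Longrightarrow> e k i * norm ((W * A * Z) $$ (i, j)
      - (if cl i = cl j then (Wk k * A * Zk k) $$ (i, j) else 0)) \<le> \<epsilon> * e k j"
      and ck: "ck (r k) < c + \<eta> / 2"
      using eventually_happens'[OF sequentially_bot] by blast
    have "weighted_norm (e k) ((W * A * Z) *\<^sub>v x) \<le> (c + \<eta>) * weighted_norm (e k) x"
      if A: "A \<in> \<M>" and x: "x \<in> carrier_vec n" for A x
    proof -
      have Ac: "A \<in> carrier_mat n n" using A M by blast
      define B where "B = Wk k * A * Zk k"
      define F where "F = mat n n (\<lambda>(i, j). if cl i = cl j then B $$ (i, j) else 0)"
      define E where "E = W * A * Z - F"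
      have Bc: "B \<in> carrier_mat n n" unfolding B_def by (rule mult_carrier_mat[OF mult_carrier_mat[OF Wk Ac] Zk])
      have Fc: "F \<in> carrier_mat n n" by (simp add: F_def)
      have WAZ: "W * A * Z \<in> carrier_mat n n" by (rule mult_carrier_mat[OF mult_carrier_mat[OF W Ac] Z])
      have Ec: "E \<in> carrier_mat n n" unfolding E_def by (rule minus_carrier_mat[OF Fc])
      have eq: "W * A * Z = F + E" by (rule eq_matI) (use Fc WAZ in \<open>auto simp: E_def\<close>)
      have "weighted_norm (e k) ((W * A * Z) *\<^sub>v x)
          \<le> weighted_norm (e k) (F *\<^sub>v x) + weighted_norm (e k) (E *\<^sub>v x)"
        unfolding eq add_mult_distrib_mat_vec[OF Fc Ec x]
        by (rule weighted_norm_triangle[of _ n]) (use Fc Ec x e in \<open>auto intro: less_imp_le\<close>)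
      also have "weighted_norm (e k) (F *\<^sub>v x) \<le> ck (r k) * weighted_norm (e k) x"
        by (rule weighted_norm_pinching_le[OF Bc Fc _ ck0 _ x, where cl = cl])
           (use contr[OF A] in \<open>auto simp: F_def B_def\<close>)
      also have "weighted_norm (e k) (E *\<^sub>v x) \<le> real n * real n * \<epsilon> * weighted_norm (e k) x"
      proof (rule weighted_norm_mult_le_entries[OF Ec x])
        fix i j assume ij: "i < n" "j < n"
        have F_ij: "F $$ (i, j) = (if cl i = cl j then B $$ (i, j) else 0)"
          using ij by (simp add: F_def)
        have "E $$ (i, j) = (W * A * Z) $$ (i, j) - F $$ (i, j)"
          unfolding E_def by (rule index_minus_mat) (use Fc ij in auto)
        then show "e k i * norm (E $$ (i, j)) \<le> \<epsilon> * e k j"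
          unfolding F_ij unfolding B_def by (simp only: k[OF ij A])
      qed (use e eps in \<open>auto intro: less_imp_le\<close>)
      also have "ck (r k) * weighted_norm (e k) x + real n * real n * \<epsilon> * weighted_norm (e k) x
          = (ck (r k) + \<eta> / 2) * weighted_norm (e k) x"
        unfolding n_eps by (simp add: distrib_right)
      also have "\<dots> \<le> (c + \<eta>) * weighted_norm (e k) x"
        by (rule mult_right_mono) (use ck in auto)
      finally show ?thesis by simp
    qed
    then show ?thesis using e by (intro exI[of _ "e k"]) auto
  qed
  show ?thesis by (rule that[OF W Z WZ ZW main])
qed

section \<open>Principal submatrices\<close>

lemma card_restrict_index: "J \<subseteq> {..<n} \<Longrightarrow> {i. i < n \<and> i \<in> J} = J" for n :: nat
  by auto

lemma submatrix_carrier: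
  assumes A: "A \<in> carrier_mat n n" and J: "J \<subseteq> {..<n}"
  shows "submatrix A J J \<in> carrier_mat (card J) (card J)"
proof -
  have "dim_row A = n" "dim_col A = n" using A by auto
  then show ?thesis
    unfolding carrier_mat_def mem_Collect_eq dim_submatrix by (simp only: card_restrict_index[OF J])
qed

lemma submatrix_entry:
  assumes A: "A \<in> carrier_mat n n" and J: "J \<subseteq> {..<n}" and ij: "i < card J" "j < card J"
  shows "submatrix A J J $$ (i, j) = A $$ (pick J i, pick J j)"
proof -
  have "dim_row A = n" "dim_col A = n" using A by auto
  then show ?thesis
    by (intro submatrix_index) (simp_all only: card_restrict_index[OF J] ij)
qed

lemma bij_betw_pick:
  assumes J: "J \<subseteq> {..<n}"
  shows "bij_betw (pick J) {..<card J} J"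
proof -
  have fin: "finite J" using J finite_subset by blast
  have "inj_on (pick J) {..<card J}"
    by (rule inj_on_inverseI[where g = "\<lambda>j. card {a \<in> J. a < j}"]) (simp add: card_pick_le)
  moreover have "pick J ` {..<card J} = J"
  proof
    show "pick J ` {..<card J} \<subseteq> J" using pick_in_set_le by auto
    show "J \<subseteq> pick J ` {..<card J}"
    proof
      fix j assume j: "j \<in> J"
      then have "{a \<in> J. a < j} \<subset> J" by auto
      then have "card {a \<in> J. a < j} < card J" by (rule psubset_card_mono[OF fin])
      then show "j \<in> pick J ` {..<card J}" using pick_card_in_set[OF j] by force
    qed
  qed
  ultimately show ?thesis by (simp add: bij_betw_def)
qed

text \<open>A principal submatrix is a compression to a coordinate subspace: pad the argument with zeros, apply
  \<open>A\<close>, and drop the coordinates outside \<open>J\<close>. The weighted norm splits over coordinates, so this keeps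
  the rate.\<close>

lemma weighted_norm_submatrix_le:
  fixes A :: "'a::real_normed_field mat"
  assumes A: "A \<in> carrier_mat n n" and J: "J \<subseteq> {..<n}" and c: "0 \<le> c"
    and b: "\<And>x. x \<in> carrier_vec n \<Longrightarrow> weighted_norm e (A *\<^sub>v x) \<le> c * weighted_norm e x"
    and x: "x \<in> carrier_vec (card J)"
  shows "weighted_norm (\<lambda>i. e (pick J i)) (submatrix A J J *\<^sub>v x) \<le> c * weighted_norm (\<lambda>i. e (pick J i)) x"
proof -
  note bij = bij_betw_pick[OF J]
  have fin: "finite J" using J finite_subset by blast
  have p: "pick J i \<in> J" "pick J i < n" if "i < card J" for i
    using bij_betwE[OF bij] that J by auto
  define q where "q = the_inv_into {..<card J} (pick J)"
  have q: "q (pick J i) = i" if "i < card J" for i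
    unfolding q_def by (rule the_inv_into_f_f) (use bij that in \<open>auto simp: bij_betw_def\<close>)
  define y where "y = vec n (\<lambda>j. if j \<in> J then x $ q j else 0)"
  have y: "y \<in> carrier_vec n" by (simp add: y_def)
  have yp: "y $ pick J i = x $ i" if "i < card J" for i using that p q by (simp add: y_def)
  have y0: "y $ j = 0" if "j < n" "j \<notin> J" for j using that by (simp add: y_def)
  have restrict: "(\<Sum>j<n. h j) = (\<Sum>i<card J. h (pick J i))" if "\<And>j. j < n \<Longrightarrow> j \<notin> J \<Longrightarrow> h j = 0"
    for h :: "nat \<Rightarrow> 'b::comm_monoid_add"
  proof -
    have "(\<Sum>j<n. h j) = (\<Sum>j\<in>J. h j)" by (rule sum.mono_neutral_right) (use J that in auto)
    then show ?thesis using sum.reindex_bij_betw[OF bij, of h] by simp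
  qed
  have S: "submatrix A J J \<in> carrier_mat (card J) (card J)" by (rule submatrix_carrier[OF A J])
  have Ay: "(submatrix A J J *\<^sub>v x) $ i = (A *\<^sub>v y) $ pick J i" if i: "i < card J" for i
  proof -
    have "(submatrix A J J *\<^sub>v x) $ i = (\<Sum>l<card J. A $$ (pick J i, pick J l) * x $ l)"
      unfolding mult_mat_vec_index[OF S x i]
      by (rule sum.cong) (use submatrix_entry[OF A J i] in auto)
    also have "\<dots> = (\<Sum>l<card J. A $$ (pick J i, pick J l) * y $ pick J l)"
      by (rule sum.cong) (auto simp: yp)
    also have "\<dots> = (\<Sum>j<n. A $$ (pick J i, j) * y $ j)"
      by (rule restrict[symmetric]) (simp add: y0)
    also have "\<dots> = (A *\<^sub>v y) $ pick J i"
      by (rule mult_mat_vec_index[OF A y p(2)[OF i], symmetric])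
    finally show ?thesis .
  qed
  have "(weighted_norm (\<lambda>i. e (pick J i)) x)\<^sup>2 = (\<Sum>i<card J. (e (pick J i))\<^sup>2 * (norm (y $ pick J i))\<^sup>2)"
    unfolding weighted_norm_square using x by (simp add: yp)
  also have "\<dots> = (\<Sum>j<n. (e j)\<^sup>2 * (norm (y $ j))\<^sup>2)"
    by (rule restrict[symmetric]) (simp add: y0)
  also have "\<dots> = (weighted_norm e y)\<^sup>2"
    unfolding weighted_norm_square using y by simp
  finally have nx: "weighted_norm (\<lambda>i. e (pick J i)) x = weighted_norm e y"
    by (rule power2_eq_imp_eq) auto
  have dim: "dim_vec (submatrix A J J *\<^sub>v x) = card J" using S by simp
  have "(weighted_norm (\<lambda>i. e (pick J i)) (submatrix A J J *\<^sub>v x))\<^sup>2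
      = (\<Sum>i<card J. (e (pick J i))\<^sup>2 * (norm ((A *\<^sub>v y) $ pick J i))\<^sup>2)"
    unfolding weighted_norm_square dim by (rule sum.cong[OF refl]) (simp only: Ay lessThan_iff)
  also have "\<dots> = (\<Sum>j\<in>J. (e j)\<^sup>2 * (norm ((A *\<^sub>v y) $ j))\<^sup>2)"
    by (rule sum.reindex_bij_betw[OF bij])
  also have "\<dots> \<le> (\<Sum>j<n. (e j)\<^sup>2 * (norm ((A *\<^sub>v y) $ j))\<^sup>2)"
    by (rule sum_mono2) (use J in auto)
  also have "\<dots> = (weighted_norm e (A *\<^sub>v y))\<^sup>2"
    unfolding weighted_norm_square using A by simp
  finally have "weighted_norm (\<lambda>i. e (pick J i)) (submatrix A J J *\<^sub>v x) \<le> weighted_norm e (A *\<^sub>v y)"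
    by (rule power2_le_imp_le) simp
  also have "\<dots> \<le> c * weighted_norm e y" by (rule b[OF y])
  finally show ?thesis by (simp only: nx)
qed

text \<open>Each entry is a continuous function on the product space in which compactness is defined.\<close>

lemma compact_mats_bounded_entries:
  fixes \<M> :: "'a::real_normed_field mat set"
  assumes M: "\<M> \<subseteq> carrier_mat n n" and cpt: "compact_mats \<M>"
  obtains C where "0 \<le> C" "\<And>A i j. A \<in> \<M> \<Longrightarrow> i < n \<Longrightarrow> j < n \<Longrightarrow> norm (A $$ (i, j)) \<le> C"
proof -
  have "\<exists>b. \<forall>A\<in>\<M>. norm (entries A i j) \<le> b" for i j
  proof -
    have "continuous_on (entries ` \<M>) (\<lambda>f. f i j)"
      by (rule continuous_on_subset[OF continuous_on_compose2[OF continuous_on_product_coordinates[of j]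
            continuous_on_product_coordinates[of i]]]) auto
    then have "compact ((\<lambda>f. f i j) ` entries ` \<M>)"
      using cpt unfolding compact_mats_def by (rule compact_continuous_image)
    then have "bounded ((\<lambda>f. f i j) ` entries ` \<M>)" by (rule compact_imp_bounded)
    then show ?thesis by (auto simp: bounded_iff)
  qed
  then obtain b where b: "\<And>i j A. A \<in> \<M> \<Longrightarrow> norm (entries A i j) \<le> b i j" by metis
  define C where "C = (\<Sum>i<n. \<Sum>j<n. \<bar>b i j\<bar>)"
  have "norm (A $$ (i, j)) \<le> C" if A: "A \<in> \<M>" and ij: "i < n" "j < n" for A i j
  proof -
    have "A \<in> carrier_mat n n" using A M by blast
    then have "norm (A $$ (i, j)) \<le> \<bar>b i j\<bar>"
      using b[OF A, of i j] ij by (auto simp: entries_def)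
    also have "\<dots> \<le> (\<Sum>j<n. \<bar>b i j\<bar>)"
      by (rule member_le_sum[where f = "\<lambda>j. \<bar>b i j\<bar>"]) (use ij in auto)
    also have "\<dots> \<le> C" unfolding C_def
      by (rule member_le_sum[where f = "\<lambda>i. \<Sum>j<n. \<bar>b i j\<bar>"]) (use ij in \<open>auto simp: sum_nonneg\<close>)
    finally show ?thesis .
  qed
  moreover have "0 \<le> C" by (simp add: C_def sum_nonneg)
  ultimately show ?thesis using that by blast
qed

text \<open>The coordinates are chosen before \<open>J\<close> and before the excess rate \<open>\<eta>\<close>; only the weights depend on
  \<open>\<eta>\<close>, and they do not affect the joint spectral radius, so \<open>\<eta>\<close> can tend to zero.\<close>

lemma ex_similarity_principal_submatrices:
  fixes \<M> :: "'a::{real_normed_field,euclidean_space} mat set"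
  assumes d: "d \<ge> 1" and M: "\<M> \<subseteq> carrier_mat d d" and ne: "\<M> \<noteq> {}" and cpt: "compact_mats \<M>"
  shows "\<exists>T \<in> carrier_mat d d. \<exists>T' \<in> carrier_mat d d.
           inverts_mat T T' \<and> inverts_mat T' T \<and>
           (\<forall>J. J \<noteq> {} \<longrightarrow> J \<subseteq> {..<d} \<longrightarrow>
              joint_spectral_radius (card J) ((\<lambda>A. submatrix A J J) ` ((\<lambda>A. T' * A * T) ` \<M>))
                \<le> sqrt (real d) * joint_spectral_radius d \<M>)"
proof -
  obtain C where C: "0 \<le> C" "\<And>A i j. A \<in> \<M> \<Longrightarrow> i < d \<Longrightarrow> j < d \<Longrightarrow> norm (A $$ (i, j)) \<le> C"
    using compact_mats_bounded_entries[OF M cpt] by blast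
  define c where "c = sqrt (real d) * joint_spectral_radius d \<M>"
  have opbound: "euclidean_norm_vec (A *\<^sub>v x) \<le> (real d * real d * C) * euclidean_norm_vec x"
    if "A \<in> \<M>" "x \<in> carrier_vec d" for A x
    by (rule euclidean_norm_mult_le_entries) (use that M C in auto)
  have c0: "0 \<le> c"
    unfolding c_def using joint_spectral_radius_nonneg[OF M ne opbound] by simp
  obtain W Z where WZ: "W \<in> carrier_mat d d" "Z \<in> carrier_mat d d" "W * Z = 1\<^sub>m d" "Z * W = 1\<^sub>m d"
    and contr: "\<And>\<eta>. 0 < \<eta> \<Longrightarrow> \<exists>e. (\<forall>i<d. 0 < e i) \<and> (\<forall>A\<in>\<M>. \<forall>x\<in>carrier_vec d.
      weighted_norm e ((W * A * Z) *\<^sub>v x) \<le> (c + \<eta>) * weighted_norm e x)"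
    using ex_common_coordinates[OF d M ne C, of c] c_def by blast
  have "joint_spectral_radius (card J) ((\<lambda>A. submatrix A J J) ` ((\<lambda>A. W * A * Z) ` \<M>)) \<le> c"
    if J: "J \<subseteq> {..<d}" for J
  proof (rule field_le_epsilon)
    fix \<eta> :: real assume eta: "0 < \<eta>"
    obtain e where e: "\<And>i. i < d \<Longrightarrow> 0 < e i" and contr_e: "\<And>A x. A \<in> \<M> \<Longrightarrow> x \<in> carrier_vec d \<Longrightarrow>
      weighted_norm e ((W * A * Z) *\<^sub>v x) \<le> (c + \<eta>) * weighted_norm e x"
      using contr[OF eta] by blast
    have WAZ: "W * A * Z \<in> carrier_mat d d" if "A \<in> \<M>" for A
      using that M WZ(1,2) by (meson mult_carrier_mat subsetD)
    show "joint_spectral_radius (card J) ((\<lambda>A. submatrix A J J) ` ((\<lambda>A. W * A * Z) ` \<M>)) \<le> c + \<eta>"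
    proof (rule joint_spectral_radius_le_weighted[where e = "\<lambda>i. e (pick J i)"])
      show "(\<lambda>A. submatrix A J J) ` ((\<lambda>A. W * A * Z) ` \<M>) \<subseteq> carrier_mat (card J) (card J)"
        using submatrix_carrier[OF WAZ J] by auto
      show "(\<lambda>A. submatrix A J J) ` ((\<lambda>A. W * A * Z) ` \<M>) \<noteq> {}" using ne by simp
      show "0 < c + \<eta>" using c0 eta by simp
      show "0 < e (pick J i)" if "i < card J" for i
        using e bij_betwE[OF bij_betw_pick[OF J]] that J by auto
      show "weighted_norm (\<lambda>i. e (pick J i)) (B *\<^sub>v x) \<le> (c + \<eta>) * weighted_norm (\<lambda>i. e (pick J i)) x"
        if B: "B \<in> (\<lambda>A. submatrix A J J) ` ((\<lambda>A. W * A * Z) ` \<M>)" and x: "x \<in> carrier_vec (card J)" for B x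
      proof -
        obtain A where A: "A \<in> \<M>" and B_eq: "B = submatrix (W * A * Z) J J" using B by blast
        show ?thesis unfolding B_eq
          by (rule weighted_norm_submatrix_le[OF WAZ[OF A] J _ contr_e[OF A] x]) (use c0 eta in simp)
      qed
    qed
  qed
  then show ?thesis
    unfolding c_def using WZ
    by (intro bexI[OF _ WZ(2)] bexI[OF _ WZ(1)] conjI allI impI) (simp_all add: inverts_mat_def)
qed

theorem theorem4p6:
  fixes d :: nat
  assumes "d \<ge> 1"
  shows
    "(\<forall>\<M> :: real mat set.
        \<M> \<subseteq> carrier_mat d d \<longrightarrow> \<M> \<noteq> {} \<longrightarrow> compact_mats \<M> \<longrightarrow>
        (\<exists>T \<in> carrier_mat d d. \<exists>T' \<in> carrier_mat d d.
           inverts_mat T T' \<and> inverts_mat T' T \<and>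
           (\<forall>J. J \<noteq> {} \<longrightarrow> J \<subseteq> {..<d} \<longrightarrow>
              joint_spectral_radius (card J) ((\<lambda>A. submatrix A J J) ` ((\<lambda>A. T' * A * T) ` \<M>))
                \<le> sqrt (real d) * joint_spectral_radius d \<M>)))
     \<and>
     (\<forall>\<M> :: complex mat set.
        \<M> \<subseteq> carrier_mat d d \<longrightarrow> \<M> \<noteq> {} \<longrightarrow> compact_mats \<M> \<longrightarrow>
        (\<exists>T \<in> carrier_mat d d. \<exists>T' \<in> carrier_mat d d.
           inverts_mat T T' \<and> inverts_mat T' T \<and>
           (\<forall>J. J \<noteq> {} \<longrightarrow> J \<subseteq> {..<d} \<longrightarrow>
              joint_spectral_radius (card J) ((\<lambda>A. submatrix A J J) ` ((\<lambda>A. T' * A * T) ` \<M>))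
                \<le> sqrt (real d) * joint_spectral_radius d \<M>)))"
  by (intro conjI allI impI ex_similarity_principal_submatrices[OF assms])

end
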